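(* Let $\mathbb{I}$ be an inertia tensor with $I_{12}=0$, and consider the reduced (Euler-Poincaré-Suslov) equations $$\dot M_1=-\frac{M_2}{I_{11}I_{22}^2}\left(I_{13}I_{22}M_1+I_{11}I_{23}M_2\right),\qquad \dot M_2=\frac{M_1}{I_{22}I_{11}^2}\left(I_{13}I_{22}M_1+I_{11}I_{23}M_2\right).$$ Then the local truncation error of the approximation of the flow of these equations by the projection of the discrete time momentum mapping $\mathcal{B}^*_{(\infty,\varepsilon)}$ onto the $M_1$-$M_2$ plane is second order. That is, for $(M_1,M_2)$ in a neighbourhood of $(0,0)$, if $(M_1(t),M_2(t))$ denotes the solution of the Euler-Poincaré-Suslov equations $\dot M_1=-\frac{M_2}{I_{11}I_{22}^2}\left(I_{13}I_{22}M_1+I_{11}I_{23}M_2\right)$, $\dot M_2=\frac{M_1}{I_{22}I_{11}^2}\left(I_{13}I_{22}M_1+I_{11}I_{23}M_2\right)$ with initial condition $(M_1(0),M_2(0))=(M_1,M_2)$, and $(\tilde M_1,\tilde M_2)$ denotes the image of $(M_1,M_2)$ under the projection of $\mathcal{B}^*_{(\infty,\varepsilon)}$ onto the $M_1$-$M_2$ plane, then $$\tilde M_i=M_i(\varepsilon)+\mathcal{O}(\varepsilon^3)\quad\text{as }\varepsilon\to0,\qquad i=1,2.$$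
   Context: The inertia tensor $\mathbb{I}$ is a symmetric positive definite $3\times 3$ real matrix with entries $I_{ij}$ and $I_{12}=0$. Vectors $\omega\in\mathbb{R}^3$ are identified with skew-symmetric matrices $\widehat\omega\in\mathfrak{so}(3)$ by $\widehat\omega\,x=\omega\times x$, and $\mathfrak{so}(3)^*$ is identified with $\mathfrak{so}(3)$ through $\langle\xi,\eta\rangle=\frac12\mathrm{Trace}(\xi\eta^T)$. The time step is $\varepsilon>0$. Let $\mathfrak{d}=\{\omega\in\mathbb{R}^3:\omega_3=0\}$, let $\mathrm{Cay}_\varepsilon(\omega)=(e+\frac{\varepsilon}{2}\widehat\omega)(e-\frac{\varepsilon}{2}\widehat\omega)^{-1}\in SO(3)$, where $e$ is the identity matrix (this map is injective), and let $\mathcal{S}=\mathrm{Cay}_\varepsilon(\mathfrak{d})$, parametrised by $(u,v)\in\mathbb{R}^2$ via $W=\mathrm{Cay}_\varepsilon(u,v,0)$. The reduced Lagrangian is $\ell(\omega)=\frac12\langle\mathbb{I}\omega,\omega\rangle$ and the reduced discrete Lagrangian is $\ell_d^{(\infty,\varepsilon)}=\varepsilon\,\ell\circ\mathrm{Cay}_\varepsilon^{-1}$, defined on the range of $\mathrm{Cay}_\varepsilon$. Its discrete Legendre transformation is defined by $\langle\mathbb{F}\ell_d^{(\infty,\varepsilon)}(W),\xi\rangle=\frac{d}{ds}\big|_{s=0}\ell_d^{(\infty,\varepsilon)}(\exp(s\xi)W)$. For $W=\mathrm{Cay}_\varepsilon(u,v,0)$ the first two components of $M=\mathbb{F}\ell_d^{(\infty,\varepsilon)}(W)$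 are $$M_1=I_{11}u+\frac\varepsilon2v(I_{13}u+I_{23}v)+\frac{\varepsilon^2}{4}u(I_{11}u^2+I_{22}v^2),\quad M_2=I_{22}v-\frac\varepsilon2u(I_{13}u+I_{23}v)+\frac{\varepsilon^2}{4}v(I_{11}u^2+I_{22}v^2).\qquad( * )$$ The momentum locus is $\mathfrak{u}^{(\infty)}_\varepsilon=\mathbb{F}\ell_d^{(\infty,\varepsilon)}(\mathcal{S})$. The discrete Euler-Poincaré-Suslov equations are $M_{k+1}=W_k^TM_kW_k+\lambda_k\widehat{e_3}$ with $e_3=(0,0,1)$, $W_k\in\mathcal{S}$, $M_k=\mathbb{F}\ell_d^{(\infty,\varepsilon)}(W_k)$, and the multiplier $\lambda_k\in\mathbb{R}$ determined by $M_{k+1}\in\mathfrak{u}^{(\infty)}_\varepsilon$. In the coordinates $(u,v)$ on $\mathcal{S}$ they are equivalent to $$p_3^+(u_{k+1},v_{k+1})=p_3^-(u_k,v_k),\qquad q_3^-(u_{k+1},v_{k+1})=q_3^+(u_k,v_k),$$ where $$p_3^\pm(u,v)=I_{11}u\pm\frac\varepsilon2v(I_{13}u+I_{23}v)+\frac{\varepsilon^2}{4}u(I_{11}u^2+I_{22}v^2),$$ $$q_3^\pm(u,v)=I_{22}v\pm\frac\varepsilon2u(I_{13}u+I_{23}v)+\frac{\varepsilon^2}{4}v(I_{11}u^2+I_{22}v^2).$$ This is a multivalued map. For $\varepsilon$ small, $\mathcal{B}_{(\infty,\varepsilon)}$ denotes the (local, single-valued) branch $(u_k,v_k)\mapsto(u_{k+1},v_{k+1})$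 depending smoothly on $(u_k,v_k,\varepsilon)$ and with $(u_{k+1},v_{k+1})\to(u_k,v_k)$ as $\varepsilon\to0$, regarded as a map on $\mathcal{S}$. The discrete time momentum mapping is the locally defined map on $\mathfrak{u}^{(\infty)}_\varepsilon$ given by $\mathcal{B}^*_{(\infty,\varepsilon)}=\mathbb{F}\ell_d^{(\infty,\varepsilon)}\circ\mathcal{B}_{(\infty,\varepsilon)}\circ(\mathbb{F}\ell_d^{(\infty,\varepsilon)})^{-1}$. Its projection onto the $M_1$-$M_2$ plane is the map $(M_1,M_2)\mapsto(\tilde M_1,\tilde M_2)$ obtained by inverting $( * )$ (smoothly, by the implicit function theorem, near $(M_1,M_2)=(0,0)$ and for small $\varepsilon$, with $(u,v)\to(M_1/I_{11},M_2/I_{22})$ as $\varepsilon\to 0$), applying $\mathcal{B}_{(\infty,\varepsilon)}$, and evaluating $( * )$ at the result. The local truncation error is second order if, after one step of size $\varepsilon$ from the same initial point, the expansions of the discrete map and of the continuous flow in powers of $\varepsilon$ agree up to and including the terms in $\varepsilon^2$. *)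

theory Defs
  imports "HOL-Analysis.Analysis" "HOL-Library.Landau_Symbols"
begin

text \<open>The set is meant to be open: all derivatives are full Frechet derivatives.\<close>

primrec Ck_on :: "nat \<Rightarrow> ('a::real_normed_vector \<Rightarrow> 'b::real_normed_vector) \<Rightarrow> 'a set \<Rightarrow> bool" where
  "Ck_on 0 f S \<longleftrightarrow> continuous_on S f"
| "Ck_on (Suc k) f S \<longleftrightarrow>
     (\<forall>x\<in>S. f differentiable (at x)) \<and>
     (\<forall>v. Ck_on k (\<lambda>x. frechet_derivative f (at x) v) S)"

definition smooth_on :: "'a::real_normed_vector set \<Rightarrow> ('a \<Rightarrow> 'b::real_normed_vector) \<Rightarrow> bool" where
  "smooth_on S f \<longleftrightarrow> (\<forall>k. Ck_on k f S)"

definition hat :: "real^3 \<Rightarrow> real^3^3" where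
  "hat \<omega> = matrix (\<lambda>x. cross3 \<omega> x)"

definition so3_pairing :: "real^3^3 \<Rightarrow> real^3^3 \<Rightarrow> real" where
  "so3_pairing \<xi> \<eta> = trace (\<xi> ** transpose \<eta>) / 2"

definition mat_exp :: "real^3^3 \<Rightarrow> real^3^3" where
  "mat_exp A = (\<Sum>n. (1 / fact n) *\<^sub>R (((**) A) ^^ n) (mat 1))"

definition Cay :: "real \<Rightarrow> real^3 \<Rightarrow> real^3^3" where
  "Cay \<epsilon> \<omega> = (mat 1 + (\<epsilon> / 2) *\<^sub>R hat \<omega>) ** matrix_inv (mat 1 - (\<epsilon> / 2) *\<^sub>R hat \<omega>)"

definition constraint_space :: "(real^3) set" where
  "constraint_space = {\<omega>. \<omega> $ 3 = 0}"

definition discrete_constraint :: "real \<Rightarrow> (real^3^3) set" where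
  "discrete_constraint \<epsilon> = Cay \<epsilon> ` constraint_space"

definition Cay_chart :: "real \<Rightarrow> real \<times> real \<Rightarrow> real^3^3" where
  "Cay_chart \<epsilon> x = Cay \<epsilon> (vector [fst x, snd x, 0])"

definition inertia_tensor :: "real^3^3 \<Rightarrow> bool" where
  "inertia_tensor I \<longleftrightarrow> transpose I = I \<and> (\<forall>x. x \<noteq> 0 \<longrightarrow> 0 < (I *v x) \<bullet> x)"

definition reduced_Lagrangian :: "real^3^3 \<Rightarrow> real^3 \<Rightarrow> real" where
  "reduced_Lagrangian I \<omega> = ((I *v \<omega>) \<bullet> \<omega>) / 2"

text \<open>Meaningful only for matrices in the range of \<^term>\<open>Cay \<epsilon>\<close>, on which
  \<^term>\<open>inv (Cay \<epsilon>)\<close> is the inverse map.\<close>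

definition discrete_Lagrangian :: "real^3^3 \<Rightarrow> real \<Rightarrow> real^3^3 \<Rightarrow> real" where
  "discrete_Lagrangian I \<epsilon> W = \<epsilon> * reduced_Lagrangian I (inv (Cay \<epsilon>) W)"

text \<open>The momentum is recorded as the vector \<open>M\<close>; the element of the dual of the Lie algebra is
  \<^term>\<open>hat M\<close>, through \<^const>\<open>so3_pairing\<close>.\<close>

definition discrete_Legendre :: "real^3^3 \<Rightarrow> real \<Rightarrow> real^3^3 \<Rightarrow> real^3" where
  "discrete_Legendre I \<epsilon> W =
     (THE M. \<forall>\<xi>. ((\<lambda>s. discrete_Lagrangian I \<epsilon> (mat_exp (s *\<^sub>R hat \<xi>) ** W))
                    has_real_derivative so3_pairing (hat M) (hat \<xi>)) (at 0))"

definition momentum_locus :: "real^3^3 \<Rightarrow> real \<Rightarrow> (real^3) set" where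
  "momentum_locus I \<epsilon> = discrete_Legendre I \<epsilon> ` discrete_constraint \<epsilon>"

text \<open>The coordinates \<open>(u, v)\<close> of \<open>W\<close> are sent to the first two components of the momentum of \<open>W\<close>.\<close>

definition plane_momentum :: "real^3^3 \<Rightarrow> real \<Rightarrow> real \<times> real \<Rightarrow> real \<times> real" where
  "plane_momentum I \<epsilon> x =
     (let M = discrete_Legendre I \<epsilon> (Cay_chart \<epsilon> x) in (M $ 1, M $ 2))"

definition discrete_EPS :: "real^3^3 \<Rightarrow> real \<Rightarrow> real^3^3 \<Rightarrow> real^3^3 \<Rightarrow> bool" where
  "discrete_EPS I \<epsilon> W W' \<longleftrightarrow>
     W \<in> discrete_constraint \<epsilon> \<and> W' \<in> discrete_constraint \<epsilon> \<and>
     (\<exists>M\<in>momentum_locus I \<epsilon>. \<exists>M'\<in>momentum_locus I \<epsilon>. \<exists>\<mu>::real.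
        M = discrete_Legendre I \<epsilon> W \<and> M' = discrete_Legendre I \<epsilon> W' \<and>
        hat M' = transpose W ** hat M ** W + \<mu> *\<^sub>R hat (vector [0, 0, 1]))"

text \<open>\<open>B \<epsilon>\<close> is, in the coordinates \<open>(u, v)\<close>, the single-valued branch of the discrete equations
  near the origin that tends to the identity as the time step tends to zero.\<close>

definition EPS_branch ::
  "real^3^3 \<Rightarrow> (real \<times> real) set \<Rightarrow> real \<Rightarrow> (real \<Rightarrow> real \<times> real \<Rightarrow> real \<times> real) \<Rightarrow> bool" where
  "EPS_branch I D \<epsilon>0 B \<longleftrightarrow>
     open D \<and> 0 \<in> D \<and> 0 < \<epsilon>0 \<and>
     smooth_on (D \<times> {0<..<\<epsilon>0}) (\<lambda>(x, \<epsilon>). B \<epsilon> x) \<and>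
     (\<forall>x\<in>D. \<forall>\<epsilon>\<in>{0<..<\<epsilon>0}. discrete_EPS I \<epsilon> (Cay_chart \<epsilon> x) (Cay_chart \<epsilon> (B \<epsilon> x))) \<and>
     (\<forall>x\<in>D. ((\<lambda>\<epsilon>. B \<epsilon> x) \<longlongrightarrow> x) (at_right 0))"

text \<open>\<open>G \<epsilon>\<close> is the smooth local inverse \<open>(M1, M2) \<mapsto> (u, v)\<close> of \<^term>\<open>plane_momentum I \<epsilon>\<close>.\<close>

definition plane_momentum_inverse ::
  "real^3^3 \<Rightarrow> (real \<times> real) set \<Rightarrow> real \<Rightarrow> (real \<Rightarrow> real \<times> real \<Rightarrow> real \<times> real) \<Rightarrow> bool" where
  "plane_momentum_inverse I N \<epsilon>0 G \<longleftrightarrow>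
     open N \<and> 0 \<in> N \<and> 0 < \<epsilon>0 \<and>
     smooth_on (N \<times> {0<..<\<epsilon>0}) (\<lambda>(m, \<epsilon>). G \<epsilon> m) \<and>
     (\<forall>m\<in>N. \<forall>\<epsilon>\<in>{0<..<\<epsilon>0}. plane_momentum I \<epsilon> (G \<epsilon> m) = m) \<and>
     (\<forall>m\<in>N. ((\<lambda>\<epsilon>. G \<epsilon> m) \<longlongrightarrow> (fst m / I $ 1 $ 1, snd m / I $ 2 $ 2)) (at_right 0))"

text \<open>The conjugate of \<open>B \<epsilon>\<close> by the Legendre transformation. Near the origin a point \<open>M\<close> of the
  momentum locus is determined by its first two components, and \<open>G \<epsilon>\<close> turns these into the
  coordinates of the \<open>W\<close> with momentum \<open>M\<close>.\<close>

definition discrete_momentum_map ::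
  "real^3^3 \<Rightarrow> (real \<Rightarrow> real \<times> real \<Rightarrow> real \<times> real) \<Rightarrow> (real \<Rightarrow> real \<times> real \<Rightarrow> real \<times> real)
     \<Rightarrow> real \<Rightarrow> real^3 \<Rightarrow> real^3" where
  "discrete_momentum_map I B G \<epsilon> M =
     discrete_Legendre I \<epsilon> (Cay_chart \<epsilon> (B \<epsilon> (G \<epsilon> (M $ 1, M $ 2))))"

text \<open>The point \<open>m\<close> of the plane is lifted to the momentum locus by means of \<open>G \<epsilon>\<close>, mapped, and
  projected back.\<close>

definition projected_momentum_map ::
  "real^3^3 \<Rightarrow> (real \<Rightarrow> real \<times> real \<Rightarrow> real \<times> real) \<Rightarrow> (real \<Rightarrow> real \<times> real \<Rightarrow> real \<times> real)
     \<Rightarrow> real \<Rightarrow> real \<times> real \<Rightarrow> real \<times> real" where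
  "projected_momentum_map I B G \<epsilon> m =
     (let M = discrete_Legendre I \<epsilon> (Cay_chart \<epsilon> (G \<epsilon> m));
          M' = discrete_momentum_map I B G \<epsilon> M
      in (M' $ 1, M' $ 2))"

lemma projected_momentum_map_eq:
  assumes "plane_momentum I \<epsilon> (G \<epsilon> m) = m"
  shows "projected_momentum_map I B G \<epsilon> m = plane_momentum I \<epsilon> (B \<epsilon> (G \<epsilon> m))"
  using assms
  by (simp add: projected_momentum_map_def discrete_momentum_map_def plane_momentum_def Let_def)

definition EPS_field :: "real^3^3 \<Rightarrow> real \<times> real \<Rightarrow> real \<times> real" where
  "EPS_field I = (\<lambda>(M1, M2).
     (- (M2 / (I $ 1 $ 1 * (I $ 2 $ 2)\<^sup>2)) * (I $ 1 $ 3 * I $ 2 $ 2 * M1 + I $ 1 $ 1 * I $ 2 $ 3 * M2),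
        (M1 / (I $ 2 $ 2 * (I $ 1 $ 1)\<^sup>2)) * (I $ 1 $ 3 * I $ 2 $ 2 * M1 + I $ 1 $ 1 * I $ 2 $ 3 * M2)))"

definition EPS_solution ::
  "real^3^3 \<Rightarrow> real \<times> real \<Rightarrow> real \<Rightarrow> (real \<Rightarrow> real \<times> real) \<Rightarrow> bool" where
  "EPS_solution I m T M \<longleftrightarrow>
     0 < T \<and> M 0 = m \<and>
     (\<forall>t\<in>{0..<T}. (M has_vector_derivative EPS_field I (M t)) (at t within {0..<T}))"

end

theory Submission
  imports Defs
begin

text \<open>
  In the coordinates \<open>(u, v)\<close> let \<open>L\<^sub>\<epsilon> = (p\<^sub>3\<^sup>+, q\<^sub>3\<^sup>-)\<close> be the projected discrete Legendre
  transformation for the step \<open>\<epsilon>\<close>. Changing the sign of \<open>\<epsilon>\<close> exchanges \<open>p\<^sub>3\<^sup>+\<close> with \<open>p\<^sub>3\<^sup>-\<close> and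
  \<open>q\<^sub>3\<^sup>-\<close> with \<open>q\<^sub>3\<^sup>+\<close>, so the discrete equations read \<open>L\<^sub>\<epsilon> x' = L\<^sub>-\<^sub>\<epsilon> x\<close> and the projected
  momentum map is \<open>m \<mapsto> L\<^sub>-\<^sub>\<epsilon> (L\<^sub>\<epsilon>\<^sup>-\<^sup>1 m)\<close>. With \<open>x = L\<^sub>\<epsilon>\<^sup>-\<^sup>1 m\<close> this equals \<open>m + \<epsilon> K x\<close>, where \<open>K\<close> is a
  pair of quadratic forms and the vector field is \<open>K \<circ> L\<^sub>0\<^sup>-\<^sup>1\<close>. Since
  \<open>L\<^sub>0 x = m + (\<epsilon> / 2) K x + O(\<epsilon>\<^sup>2)\<close>, the scheme agrees with the implicit midpoint rule up to \<open>O(\<epsilon>\<^sup>3)\<close>.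
  The map \<open>(x, \<epsilon>) \<mapsto> (L\<^sub>\<epsilon> x, \<epsilon>)\<close> is a local diffeomorphism at the origin, \<open>\<epsilon> = 0\<close> included, which
  gives the smooth branches. The Legendre transformation itself is computed with Gibbs--Rodrigues
  vectors: both \<open>Cay\<close> and \<open>exp\<close> are rotations with an explicit Gibbs vector, and these compose by a
  rational formula.
\<close>

section \<open>Functions of class \<open>C\<^sup>k\<close>\<close>

text \<open>On an open set, equality on \<open>S\<close> is equality near each point, so the Frechet
  derivatives agree on \<open>S\<close> as well and the induction passes to them.\<close>

lemma Ck_on_cong:
  assumes "open S" "\<And>x. x \<in> S \<Longrightarrow> f x = g x" "Ck_on k f S"
  shows "Ck_on k g S"
  using assms(2,3)
proof (induction k arbitrary: f g)
  case 0
  then show ?case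
    using continuous_on_cong[of S S f g] by simp
next
  case (Suc k)
  have der: "(g has_derivative frechet_derivative f (at x)) (at x)" if "x \<in> S" for x
    using Suc.prems that assms(1) frechet_derivative_works
    by (metis (no_types, lifting) Ck_on.simps(2) has_derivative_transform_within_open)
  have "Ck_on k (\<lambda>x. frechet_derivative g (at x) v) S" for v
    by (rule Suc.IH[where f = "\<lambda>x. frechet_derivative f (at x) v"])
      (use Suc.prems der frechet_derivative_at in \<open>fastforce+\<close>)
  then show ?case
    using der by (auto simp: differentiable_def)
qed

text \<open>This lets an explicit derivative stand in for \<open>frechet_derivative\<close>; the
  closure rules for products, compositions and inverses rest on it.\<close>

lemma Ck_on_SucI:
  assumes "open S" "\<And>x. x \<in> S \<Longrightarrow> (f has_derivative f' x) (at x)"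
    and "\<And>v. Ck_on k (\<lambda>x. f' x v) S"
  shows "Ck_on (Suc k) f S"
proof -
  have "Ck_on k (\<lambda>x. frechet_derivative f (at x) v) S" for v
    by (rule Ck_on_cong[OF assms(1) _ assms(3)[of v]]) (metis assms(2) frechet_derivative_at)
  then show ?thesis
    using assms(2) by (auto simp: differentiable_def)
qed

lemma Ck_on_Suc_has_derivative:
  assumes "Ck_on (Suc k) f S" "x \<in> S"
  shows "(f has_derivative frechet_derivative f (at x)) (at x)"
  using assms frechet_derivative_works by auto

lemma Ck_on_SucD: "Ck_on (Suc k) f S \<Longrightarrow> Ck_on k f S"
proof (induction k arbitrary: f)
  case 0
  then show ?case
    by (simp add: continuous_at_imp_continuous_on differentiable_imp_continuous_within)
qed auto

lemma Ck_on_continuous: "Ck_on k f S \<Longrightarrow> continuous_on S f"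
  by (induction k) (simp, metis Ck_on_SucD)

lemma Ck_on_subset: "Ck_on k f S \<Longrightarrow> T \<subseteq> S \<Longrightarrow> Ck_on k f T"
  by (induction k arbitrary: f) (auto intro: continuous_on_subset)

lemma Ck_on_const: "Ck_on k (\<lambda>x. c) S"
  by (induction k arbitrary: c) auto

lemma Ck_on_bounded_linear:
  assumes "bounded_linear f"
  shows "Ck_on k f S"
proof -
  have "frechet_derivative f (at x) = f" for x
    by (metis assms bounded_linear_imp_has_derivative frechet_derivative_at)
  then show ?thesis
    using assms
    by (cases k) (auto simp: Ck_on_const bounded_linear_imp_differentiable linear_continuous_on)
qed

lemma Ck_on_compose_linear:
  assumes "bounded_linear L" "open S" "Ck_on k f S"
  shows "Ck_on k (\<lambda>x. L (f x)) S"
  using assms(3)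
proof (induction k arbitrary: f)
  case 0
  then show ?case
    using assms(1) by (simp add: bounded_linear.continuous_on)
next
  case (Suc k)
  show ?case
  proof (rule Ck_on_SucI[OF assms(2)])
    show "((\<lambda>x. L (f x)) has_derivative (\<lambda>v. L (frechet_derivative f (at x) v))) (at x)"
      if "x \<in> S" for x
      using bounded_linear.has_derivative[OF assms(1)] Ck_on_Suc_has_derivative[OF Suc.prems that]
      by blast
  qed (use Suc in auto)
qed

lemma Ck_on_add:
  assumes "open S" "Ck_on k f S" "Ck_on k g S"
  shows "Ck_on k (\<lambda>x. f x + g x) S"
  using assms(2,3)
proof (induction k arbitrary: f g)
  case 0
  then show ?case by (simp add: continuous_on_add)
next
  case (Suc k)
  show ?case
    by (rule Ck_on_SucI[OF assms(1)
          has_derivative_add[OF Ck_on_Suc_has_derivative[OF Suc.prems(1)]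
            Ck_on_Suc_has_derivative[OF Suc.prems(2)]]])
      (use Suc in auto)
qed

text \<open>The product rule expresses the derivative by two values of the same \<open>h\<close>, so
  the induction hypothesis, general in \<open>f\<close> and \<open>g\<close>, applies to both
  summands.\<close>

lemma Ck_on_bilinear:
  assumes h: "bounded_bilinear h" and "open S" "Ck_on k f S" "Ck_on k g S"
  shows "Ck_on k (\<lambda>x. h (f x) (g x)) S"
  using assms(3,4)
proof (induction k arbitrary: f g)
  case 0
  then show ?case by (simp add: bounded_bilinear.continuous_on[OF h])
next
  case (Suc k)
  show ?case
  proof (rule Ck_on_SucI[OF assms(2)
        bounded_bilinear.FDERIV[OF h Ck_on_Suc_has_derivative[OF Suc.prems(1)]
          Ck_on_Suc_has_derivative[OF Suc.prems(2)]]])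
    show "Ck_on k (\<lambda>x. h (f x) (frechet_derivative g (at x) v)
        + h (frechet_derivative f (at x) v) (g x)) S" for v
      using Suc.prems Ck_on_SucD[OF Suc.prems(1)] Ck_on_SucD[OF Suc.prems(2)]
      by (intro Ck_on_add Suc.IH assms(2)) auto
  qed
qed

lemmas Ck_on_mult = Ck_on_bilinear[OF bounded_bilinear_mult]
lemmas Ck_on_scaleR = Ck_on_bilinear[OF bounded_bilinear_scaleR]

lemma Ck_on_minus: "open S \<Longrightarrow> Ck_on k f S \<Longrightarrow> Ck_on k (\<lambda>x. - f x) S"
  by (rule Ck_on_compose_linear[OF bounded_linear_minus[OF bounded_linear_ident]])

lemma Ck_on_diff:
  "open S \<Longrightarrow> Ck_on k f S \<Longrightarrow> Ck_on k g S \<Longrightarrow> Ck_on k (\<lambda>x. f x - g x) S"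
  using Ck_on_add[of S k f "\<lambda>x. - g x"] Ck_on_minus[of S k g] by simp

lemma Ck_on_sum:
  assumes "open S" "\<And>i. i \<in> A \<Longrightarrow> Ck_on k (f i) S"
  shows "Ck_on k (\<lambda>x. \<Sum>i\<in>A. f i x) S"
  using assms(2) by (induction A rule: infinite_finite_induct) (auto intro: Ck_on_const Ck_on_add assms(1))

lemma Ck_on_power:
  fixes f :: "'a::real_normed_vector \<Rightarrow> 'b::real_normed_algebra_1"
  shows "open S \<Longrightarrow> Ck_on k f S \<Longrightarrow> Ck_on k (\<lambda>x. f x ^ n) S"
  by (induction n) (auto intro: Ck_on_const Ck_on_mult)

lemma Ck_on_Pair:
  assumes "open S" "Ck_on k f S" "Ck_on k g S"
  shows "Ck_on k (\<lambda>x. (f x, g x)) S"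
proof -
  have "bounded_linear (\<lambda>y::'b. (y, 0::'c))" "bounded_linear (\<lambda>z::'c. (0::'b, z))"
    by (intro bounded_linear_Pair bounded_linear_ident bounded_linear_zero)+
  then have "Ck_on k (\<lambda>x. (f x, 0) + (0, g x)) S"
    using Ck_on_add[OF assms(1) Ck_on_compose_linear[OF _ assms(1,2)]
        Ck_on_compose_linear[OF _ assms(1,3)]] by blast
  then show ?thesis by simp
qed

text \<open>In the chain rule the direction in which \<open>f\<close> is differentiated varies with
  \<open>x\<close>, whereas \<open>Ck_on\<close> looks at fixed directions. Expanding it in a basis
  leaves products of coefficients with compositions of \<open>g\<close> and directional derivatives
  of \<open>f\<close>, which are one order lower.\<close>

lemma Ck_on_compose:
  fixes g :: "'a::real_normed_vector \<Rightarrow> 'b::euclidean_space"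
  assumes "open S" "open T" "Ck_on k f T" "Ck_on k g S" "\<And>x. x \<in> S \<Longrightarrow> g x \<in> T"
  shows "Ck_on k (\<lambda>x. f (g x)) S"
  using assms(3,4)
proof (induction k arbitrary: f)
  case 0
  then show ?case
    using assms(5) by (auto intro: continuous_on_compose2)
next
  case (Suc k)
  let ?Dg = "\<lambda>x v. frechet_derivative g (at x) v"
  show ?case
  proof (rule Ck_on_SucI[OF assms(1)])
    fix x assume x: "x \<in> S"
    have D: "(f has_derivative frechet_derivative f (at (g x))) (at (g x))"
      using Ck_on_Suc_has_derivative[OF Suc.prems(1)] assms(5) x by blast
    have *: "frechet_derivative f (at (g x)) w
        = (\<Sum>b\<in>Basis. (w \<bullet> b) *\<^sub>R frechet_derivative f (at (g x)) b)" for w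
    proof -
      have "linear (frechet_derivative f (at (g x)))"
        using D has_derivative_linear by blast
      then have "frechet_derivative f (at (g x)) (\<Sum>b\<in>Basis. (w \<bullet> b) *\<^sub>R b)
        = (\<Sum>b\<in>Basis. (w \<bullet> b) *\<^sub>R frechet_derivative f (at (g x)) b)"
        by (simp add: linear_sum linear_cmul)
      then show ?thesis
        by (simp add: euclidean_representation)
    qed
    show "((\<lambda>x. f (g x)) has_derivative
        (\<lambda>v. \<Sum>b\<in>Basis. (?Dg x v \<bullet> b) *\<^sub>R frechet_derivative f (at (g x)) b)) (at x)"
      using has_derivative_compose[OF Ck_on_Suc_has_derivative[OF Suc.prems(2) x] D]
      by (subst *[symmetric])
  next
    fix v
    show "Ck_on k (\<lambda>x. \<Sum>b\<in>Basis. (?Dg x v \<bullet> b) *\<^sub>R frechet_derivative f (at (g x)) b) S"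
      using Suc.prems Ck_on_SucD[OF Suc.prems(2)]
      by (intro Ck_on_sum Ck_on_scaleR assms(1) Suc.IH
          Ck_on_compose_linear[OF bounded_linear_inner_left]) auto
  qed
qed

text \<open>The derivative is a polynomial in the derivative of \<open>f\<close> and in
  \<open>inverse (f x)\<close> itself, which the induction provides to one order less.\<close>

lemma Ck_on_inverse:
  fixes f :: "'a::real_normed_vector \<Rightarrow> 'b::real_normed_field"
  assumes "open S" "Ck_on k f S" "\<And>x. x \<in> S \<Longrightarrow> f x \<noteq> 0"
  shows "Ck_on k (\<lambda>x. inverse (f x)) S"
  using assms(2)
proof (induction k)
  case 0
  then show ?case
    using assms(3) by (auto intro: continuous_on_inverse)
next
  case (Suc k)
  show ?case
  proof (rule Ck_on_SucI[OF assms(1)])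
    show "((\<lambda>x. inverse (f x)) has_derivative
        (\<lambda>v. - (inverse (f x) * frechet_derivative f (at x) v * inverse (f x)))) (at x)"
      if "x \<in> S" for x
      using Deriv.has_derivative_inverse[OF assms(3)[OF that]
          Ck_on_Suc_has_derivative[OF Suc.prems that]] .
    show "Ck_on k (\<lambda>x. - (inverse (f x) * frechet_derivative f (at x) v * inverse (f x))) S" for v
      using Suc.IH[OF Ck_on_SucD[OF Suc.prems]] Suc.prems
      by (intro Ck_on_minus Ck_on_mult assms(1)) auto
  qed
qed

lemma Ck_on_divide:
  fixes f g :: "'a::real_normed_vector \<Rightarrow> 'b::real_normed_field"
  assumes "open S" "Ck_on k f S" "Ck_on k g S" "\<And>x. x \<in> S \<Longrightarrow> g x \<noteq> 0"
  shows "Ck_on k (\<lambda>x. f x / g x) S"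
  using Ck_on_mult[OF assms(1,2) Ck_on_inverse[OF assms(1,3,4)]] by (simp add: divide_inverse)

lemmas Ck_on_fst = Ck_on_compose_linear[OF bounded_linear_fst]
lemmas Ck_on_snd = Ck_on_compose_linear[OF bounded_linear_snd]
lemmas Ck_on_ident = Ck_on_bounded_linear[OF bounded_linear_ident]

lemmas Ck_on_intros = Ck_on_const Ck_on_ident Ck_on_fst Ck_on_snd Ck_on_add Ck_on_diff Ck_on_minus
  Ck_on_mult Ck_on_power Ck_on_Pair Ck_on_divide

section \<open>Smooth local inverses of planar maps depending on a parameter\<close>

definition partial :: "'a::real_normed_vector \<Rightarrow> ('a \<Rightarrow> real) \<Rightarrow> 'a \<Rightarrow> real" where
  "partial v P z = frechet_derivative P (at z) v"

text \<open>Only the two planar variables enter. Since the map in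
  \<open>planar_smooth_inverse\<close> carries the parameter along unchanged, this is also its full
  Jacobian determinant.\<close>

definition planar_jacobian :: "((real \<times> real) \<times> real \<Rightarrow> real) \<Rightarrow> ((real \<times> real) \<times> real \<Rightarrow> real)
    \<Rightarrow> (real \<times> real) \<times> real \<Rightarrow> real" where
  "planar_jacobian P Q z = partial ((1, 0), 0) P z * partial ((0, 1), 0) Q z
      - partial ((0, 1), 0) P z * partial ((1, 0), 0) Q z"

lemma Ck_on_partial: "smooth_on S P \<Longrightarrow> Ck_on k (partial v P) S"
  unfolding smooth_on_def partial_def by (metis Ck_on.simps(2))

text \<open>The inverse function theorem gives a local homeomorphism with inverse \<open>g\<close>.
  The derivative of \<open>g\<close> at \<open>y\<close> is the inverse matrix
  \<open>h (g y)\<close>, a rational expression in partial derivatives evaluated at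
  \<open>g y\<close>. Hence class C^k of \<open>g\<close> implies class C^(k+1), and induction
  yields smoothness.\<close>

theorem planar_smooth_inverse:
  fixes P Q :: "(real \<times> real) \<times> real \<Rightarrow> real"
  assumes f_def: "f = (\<lambda>z. ((P z, Q z), snd z))" and P: "smooth_on UNIV P" and Q: "smooth_on UNIV Q" and J: "planar_jacobian P Q z0 \<noteq> 0"
  obtains U V g where "open U" "z0 \<in> U" "open V" "f z0 \<in> V" "homeomorphism U V f g"
    "smooth_on V g"
proof -
  let ?J = "planar_jacobian P Q"
  let ?Pu = "partial ((1, 0), 0) P" and ?Pv = "partial ((0, 1), 0) P" and ?Pe = "partial ((0, 0), 1) P"
  let ?Qu = "partial ((1, 0), 0) Q" and ?Qv = "partial ((0, 1), 0) Q" and ?Qe = "partial ((0, 0), 1) Q"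
  note CP = Ck_on_partial[OF P] and CQ = Ck_on_partial[OF Q]
  \<comment> \<open>\<open>f' z\<close> is the Jacobian matrix; \<open>h z\<close> is its inverse by
    Cramer's rule, after the contribution of the parameter has been moved to the right-hand
    side.\<close>
  define f' where "f' z w = ((?Pu z * fst (fst w) + ?Pv z * snd (fst w) + ?Pe z * snd w,
      ?Qu z * fst (fst w) + ?Qv z * snd (fst w) + ?Qe z * snd w), snd w)" for z w
  define h where "h z w = (((?Qv z * (fst (fst w) - ?Pe z * snd w) - ?Pv z * (snd (fst w) - ?Qe z * snd w)) / ?J z,
      (?Pu z * (snd (fst w) - ?Qe z * snd w) - ?Qu z * (fst (fst w) - ?Pe z * snd w)) / ?J z), snd w)" for z w
  have CJ: "Ck_on k ?J UNIV" for k
    unfolding planar_jacobian_def by (intro Ck_on_intros CP CQ open_UNIV)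
  define U0 where "U0 = {z. ?J z \<noteq> 0}"
  have U0: "open U0"
    unfolding U0_def using Ck_on_continuous[OF CJ]
    by (intro open_Collect_neq) (auto intro: continuous_intros)
  have bl_f': "bounded_linear (f' z)" for z
    unfolding f'_def
    by (intro bounded_linear_Pair bounded_linear_add bounded_linear_const_mult
        bounded_linear_fst_comp bounded_linear_snd_comp bounded_linear_ident bounded_linear_fst bounded_linear_snd)
  have bl_h: "bounded_linear (h z)" for z
    unfolding linear_conv_bounded_linear[symmetric]
    by (rule linearI) (simp_all add: h_def algebra_simps add_divide_distrib diff_divide_distrib)
  have fh: "f' z (h z w) = w" if "z \<in> U0" for z w
  proof -
    have *: "a * ((d * x - b * y) / (a * d - b * c)) + b * ((a * y - c * x) / (a * d - b * c)) = x"
      "c * ((d * x - b * y) / (a * d - b * c)) + d * ((a * y - c * x) / (a * d - b * c)) = y"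
      if "a * d - b * c \<noteq> 0" for a b c d x y :: real
      using that by (simp_all add: divide_simps) (simp_all add: algebra_simps)
    show ?thesis
      using that *[of "?Pu z" "?Qv z" "?Pv z" "?Qu z"]
      by (simp add: f'_def h_def U0_def planar_jacobian_def prod_eq_iff)
  qed
  have lin: "frechet_derivative R (at z) w
      = partial ((1, 0), 0) R z * fst (fst w) + partial ((0, 1), 0) R z * snd (fst w)
        + partial ((0, 0), 1) R z * snd w"
    and has_der: "(R has_derivative frechet_derivative R (at z)) (at z)"
    if "smooth_on UNIV R" for R z and w :: "(real \<times> real) \<times> real"
  proof -
    show D: "(R has_derivative frechet_derivative R (at z)) (at z)"
      using that Ck_on_Suc_has_derivative[of 0 R UNIV z] unfolding smooth_on_def by blast
    have w: "w = fst (fst w) *\<^sub>R ((1, 0), 0) + snd (fst w) *\<^sub>R ((0, 1), 0) + snd w *\<^sub>R ((0, 0), 1)"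
      by (simp add: prod_eq_iff)
    show "frechet_derivative R (at z) w
      = partial ((1, 0), 0) R z * fst (fst w) + partial ((0, 1), 0) R z * snd (fst w)
        + partial ((0, 0), 1) R z * snd w"
      unfolding partial_def
      by (subst w) (simp only: linear_add[OF has_derivative_linear[OF D]]
          linear_cmul[OF has_derivative_linear[OF D]] real_scaleR_def mult.commute)
  qed
  have der: "(f has_derivative f' z) (at z)" for z
    unfolding f_def f'_def lin[OF P, symmetric] lin[OF Q, symmetric]
    by (intro has_derivative_Pair has_der P Q derivative_intros)
  have cont_f': "continuous_on U0 (\<lambda>z. Blinfun (f' z))"
  proof (rule continuous_on_blinfun_componentwise)
    fix i :: "(real \<times> real) \<times> real"
    show "continuous_on U0 (\<lambda>z. blinfun_apply (Blinfun (f' z)) i)"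
      unfolding bounded_linear_Blinfun_apply[OF bl_f'] f'_def
      by (intro continuous_intros continuous_on_subset[OF Ck_on_continuous[OF CP] subset_UNIV]
          continuous_on_subset[OF Ck_on_continuous[OF CQ] subset_UNIV])
  qed
  \<comment> \<open>In finite dimension a right inverse of a linear endomorphism is also a left
    inverse.\<close>
  have hf: "h z (f' z w) = w" if "z \<in> U0" for z w
  proof -
    have "h z \<circ> f' z = id"
      using linear_inverse_left[of "f' z" "h z"] bl_f' bl_h fh[OF that]
      by (auto simp: linear_conv_bounded_linear)
    then show ?thesis
      by (metis comp_apply id_apply)
  qed
  have z0: "z0 \<in> U0"
    using J by (simp add: U0_def)
  obtain U V g g' where UV: "open U" "U \<subseteq> U0" "z0 \<in> U" "open V" "f z0 \<in> V" "homeomorphism U V f g"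
    and g': "\<And>y. y \<in> V \<Longrightarrow> (g has_derivative g' y) (at y)"
  proof (rule inverse_function_theorem[OF U0 _ cont_f' z0, of f "Blinfun (h z0)"])
    show "(f has_derivative blinfun_apply (Blinfun (f' x))) (at x)" for x
      using der by (simp add: bounded_linear_Blinfun_apply bl_f')
    show "Blinfun (h z0) o\<^sub>L Blinfun (f' z0) = id_blinfun"
      by (rule blinfun_eqI) (simp add: bounded_linear_Blinfun_apply bl_f' bl_h hf z0)
  qed blast
  have gV: "g y \<in> U" "g y \<in> U0" "f (g y) = y" if "y \<in> V" for y
    using UV(2,6) that unfolding homeomorphism_def by blast+
  have J_g: "?J (g y) \<noteq> 0" if "y \<in> V" for y
    using gV(2)[OF that] by (simp add: U0_def)
  have dg: "(g has_derivative h (g y)) (at y)" if "y \<in> V" for y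
  proof (rule has_derivative_inverse_strong_x[OF UV(1)])
    show "f' (g y) \<circ> h (g y) = id"
      by (rule ext) (simp only: comp_apply id_apply fh[OF gV(2)[OF that]])
    show "f (g y) = y" "g y \<in> U"
      using gV that by blast+
    show "continuous_on U f"
      using UV(6) by (simp only: homeomorphism_def)
    show "g (f x) = x" if "x \<in> U" for x
      using UV(6) that unfolding homeomorphism_def by blast
  qed (rule der)
  have "Ck_on k g V" for k
  proof (induction k)
    case 0
    then show ?case
      using UV by (simp add: homeomorphism_def)
  next
    case (Suc k)
    have comp: "Ck_on k (\<lambda>y. partial v P (g y)) V" "Ck_on k (\<lambda>y. partial v Q (g y)) V"
      "Ck_on k (\<lambda>y. ?J (g y)) V" for v
      by (rule Ck_on_compose[OF UV(4) open_UNIV _ Suc.IH UNIV_I], rule CP CQ CJ)+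
    show ?case
    proof (rule Ck_on_SucI[OF UV(4) dg])
      show "Ck_on k (\<lambda>y. h (g y) v) V" for v
        unfolding h_def
        
        by (intro Ck_on_intros comp UV(4)) (erule J_g)+
    qed
  qed
  then show ?thesis
    using that UV by (auto simp: smooth_on_def)
qed

section \<open>Gibbs vectors and the discrete Legendre transformation\<close>

lemma hat_components:
  "hat a $ 1 $ 1 = 0" "hat a $ 1 $ 2 = - (a $ 3)" "hat a $ 1 $ 3 = a $ 2"
  "hat a $ 2 $ 1 = a $ 3" "hat a $ 2 $ 2 = 0" "hat a $ 2 $ 3 = - (a $ 1)"
  "hat a $ 3 $ 1 = - (a $ 2)" "hat a $ 3 $ 2 = a $ 1" "hat a $ 3 $ 3 = 0"
  by (simp_all add: hat_def matrix_def cross_components axis_def)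

lemma mat_1_components:
  "(mat 1 :: real^3^3) $ i $ j = (if i = j then 1 else 0)"
  by (simp add: mat_def)

lemmas matrix3_simps = vec_eq_iff forall_3 matrix_matrix_mult_def sum_3 hat_components
  mat_1_components inner_vec_def cross_components transpose_def

lemma hat_scaleR: "hat (c *\<^sub>R a) = c *\<^sub>R hat a"
  by (simp add: matrix3_simps)

lemma matrix_mult_scaleR:
  fixes A :: "real^'n^'m" and B :: "real^'k^'n"
  shows "(c *\<^sub>R A) ** B = c *\<^sub>R (A ** B)" "A ** (c *\<^sub>R B) = c *\<^sub>R (A ** B)"
  by (simp_all add: scalar_matrix_assoc matrix_scalar_ac)

lemma so3_pairing_hat: "so3_pairing (hat a) (hat b) = a \<bullet> b"
  by (simp add: so3_pairing_def trace_def matrix3_simps)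

text \<open>The matrix of \<open>x \<mapsto> q x q\<^sup>*\<close> for the quaternion \<open>q\<close> with real part \<open>w\<close> and imaginary
  part \<open>a\<close>. Working without normalisation keeps all identities polynomial.\<close>

definition quat_matrix :: "real \<Rightarrow> real^3 \<Rightarrow> real^3^3" where
  "quat_matrix w a = (w\<^sup>2 + a \<bullet> a) *\<^sub>R mat 1 + (2 * w) *\<^sub>R hat a + 2 *\<^sub>R (hat a ** hat a)"

text \<open>Conjugation by a product of quaternions is the composite of the conjugations; the
  arguments on the right are the real and imaginary parts of the product (w + a)(w' + b).\<close>

lemma quat_matrix_mult:
  "quat_matrix w a ** quat_matrix w' b
    = quat_matrix (w * w' - a \<bullet> b) (w *\<^sub>R b + w' *\<^sub>R a + cross3 a b)"
  by (simp add: matrix3_simps quat_matrix_def) (intro conjI; algebra)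

lemma quat_matrix_scale: "quat_matrix (c * w) (c *\<^sub>R a) = c\<^sup>2 *\<^sub>R quat_matrix w a"
  by (simp add: matrix3_simps quat_matrix_def) (intro conjI; algebra)

text \<open>The rotation about the axis \<open>a\<close> by the angle whose half has tangent
  \<open>norm a\<close>: conjugation by the quaternion 1 + a, normalised by its squared
  norm.\<close>

definition gibbs_rotation :: "real^3 \<Rightarrow> real^3^3" where
  "gibbs_rotation a = (1 / (1 + a \<bullet> a)) *\<^sub>R quat_matrix 1 a"

lemma one_plus_inner_pos: "0 < 1 + a \<bullet> (a :: 'a::real_inner)"
  by (simp add: add_pos_nonneg)

lemma gibbs_rotation_eq:
  "gibbs_rotation a = mat 1 + (2 / (1 + a \<bullet> a)) *\<^sub>R (hat a + hat a ** hat a)"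
  using one_plus_inner_pos[of a]
  by (simp add: gibbs_rotation_def quat_matrix_def scaleR_add_right)

text \<open>The quaternion product (1 + a)(1 + b) has real part \<open>1 - a \<bullet> b\<close>,
  which the assumption makes nonzero. Dividing by it restores real part 1 and leaves the rotation
  unchanged.\<close>

lemma gibbs_rotation_mult:
  assumes "a \<bullet> b \<noteq> 1"
  shows "gibbs_rotation a ** gibbs_rotation b
    = gibbs_rotation ((1 / (1 - a \<bullet> b)) *\<^sub>R (a + b + cross3 a b))"
proof -
  define d where "d = 1 - a \<bullet> b"
  define c where "c = a + b + cross3 a b"
  have d: "d \<noteq> 0"
    using assms by (simp add: d_def)
  \<comment> \<open>The squared norm of quaternions is multiplicative.\<close>
  have norm: "(1 + a \<bullet> a) * (1 + b \<bullet> b) = d\<^sup>2 + c \<bullet> c"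
    unfolding c_def d_def by (simp add: matrix3_simps) algebra
  have "gibbs_rotation ((1 / d) *\<^sub>R c) = (1 / (d\<^sup>2 + c \<bullet> c)) *\<^sub>R quat_matrix d c"
  proof -
    have "quat_matrix d c = d\<^sup>2 *\<^sub>R quat_matrix 1 ((1 / d) *\<^sub>R c)"
      using quat_matrix_scale[of d 1 "(1 / d) *\<^sub>R c"] d by simp
    moreover have "1 / (1 + ((1 / d) *\<^sub>R c) \<bullet> ((1 / d) *\<^sub>R c)) = d\<^sup>2 / (d\<^sup>2 + c \<bullet> c)"
      using d by (simp add: divide_simps power2_eq_square)
    ultimately show ?thesis
      by (simp add: gibbs_rotation_def)
  qed
  moreover have "gibbs_rotation a ** gibbs_rotation b
      = (1 / ((1 + a \<bullet> a) * (1 + b \<bullet> b))) *\<^sub>R quat_matrix d c"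
  proof -
    have "quat_matrix 1 a ** quat_matrix 1 b = quat_matrix d c"
      by (simp add: quat_matrix_mult d_def c_def add.commute)
    then show ?thesis
      by (simp add: gibbs_rotation_def matrix_mult_scaleR)
  qed
  ultimately show ?thesis
    by (simp add: norm c_def d_def)
qed

text \<open>The trace determines \<open>1 + a \<bullet> a\<close>; with this factor known, the
  skew-symmetric part determines \<open>a\<close>.\<close>

lemma gibbs_rotation_inject: "gibbs_rotation a = gibbs_rotation b \<longleftrightarrow> a = b"
proof
  have tr: "trace (gibbs_rotation a) + 1 = 4 / (1 + a \<bullet> a)" for a
  proof -
    have "trace (quat_matrix 1 a) + (1 + a \<bullet> a) = 4"
      by (simp add: trace_def quat_matrix_def matrix3_simps)
    moreover have "trace (gibbs_rotation a) = trace (quat_matrix 1 a) / (1 + a \<bullet> a)"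
      by (simp add: gibbs_rotation_def trace_def sum_3 add_divide_distrib)
    ultimately show ?thesis
      using one_plus_inner_pos[of a] by (simp add: divide_simps) (simp add: algebra_simps)
  qed
  have skew: "gibbs_rotation a - transpose (gibbs_rotation a) = (4 / (1 + a \<bullet> a)) *\<^sub>R hat a" for a
  proof -
    have "quat_matrix 1 a - transpose (quat_matrix 1 a) = 4 *\<^sub>R hat a"
      by (simp add: quat_matrix_def matrix3_simps)
    then have "(1 / (1 + a \<bullet> a)) *\<^sub>R (quat_matrix 1 a - transpose (quat_matrix 1 a))
        = (1 / (1 + a \<bullet> a)) *\<^sub>R 4 *\<^sub>R hat a"
      by simp
    then show ?thesis
      by (simp add: gibbs_rotation_def scaleR_diff_right transpose_scalar)
  qed
  assume eq: "gibbs_rotation a = gibbs_rotation b"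
  have "(4 / (1 + a \<bullet> a)) *\<^sub>R hat a = (4 / (1 + a \<bullet> a)) *\<^sub>R hat b"
    using skew[of a] skew[of b] tr[of a] tr[of b] eq by metis
  then have "hat a = hat b"
    using one_plus_inner_pos[of a] by simp
  then show "a = b"
    by (simp add: matrix3_simps)
qed simp

lemma matrix_inv_unique:
  fixes A B :: "real^'n^'n"
  assumes "A ** B = mat 1"
  shows "matrix_inv A = B"
proof -
  have "B ** A = mat 1"
    using assms matrix_left_right_inverse by blast
  then have "A ** matrix_inv A = mat 1 \<and> matrix_inv A ** A = mat 1"
    unfolding matrix_inv_def using assms by (metis (mono_tags, lifting) someI)
  then show ?thesis
    by (metis \<open>B ** A = mat 1\<close> matrix_mul_assoc matrix_mul_lid matrix_mul_rid)
qed

lemma Cay_eq_gibbs_rotation: "Cay \<epsilon> \<omega> = gibbs_rotation ((\<epsilon> / 2) *\<^sub>R \<omega>)"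
proof -
  define a where "a = (\<epsilon> / 2) *\<^sub>R \<omega>"
  \<comment> \<open>The cube of \<open>hat a\<close> is \<open>hat a\<close> times
    \<open>- (a \<bullet> a)\<close>, so the inverse of \<open>mat 1 - hat a\<close> is a quadratic
    polynomial in \<open>hat a\<close>. \<open>N\<close> is this inverse times
    \<open>1 + a \<bullet> a\<close>.\<close>
  define N where "N = (1 + a \<bullet> a) *\<^sub>R mat 1 + hat a + hat a ** hat a"
  have n: "1 + a \<bullet> a \<noteq> 0"
    using one_plus_inner_pos[of a] by simp
  have "(mat 1 - hat a) ** N = (1 + a \<bullet> a) *\<^sub>R mat 1"
    unfolding N_def by (simp add: matrix3_simps) (intro conjI; algebra)
  then have inv: "matrix_inv (mat 1 - hat a) = (1 / (1 + a \<bullet> a)) *\<^sub>R N"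
    using n by (intro matrix_inv_unique)
      (simp_all add: matrix_mult_scaleR)
  have "(mat 1 + hat a) ** N = quat_matrix 1 a"
    unfolding N_def by (simp add: matrix3_simps quat_matrix_def) (intro conjI; algebra)
  then show ?thesis
    by (simp add: Cay_def inv gibbs_rotation_def hat_scaleR[symmetric] a_def[symmetric]
        matrix_mult_scaleR)
qed

lemma inj_Cay: "\<epsilon> \<noteq> 0 \<Longrightarrow> inj (Cay \<epsilon>)"
  by (rule injI) (simp add: Cay_eq_gibbs_rotation gibbs_rotation_inject)

section \<open>The exponential of a skew-symmetric matrix\<close>

text \<open>Rodrigues' formula: as the cube of \<open>K\<close> is a multiple of \<open>K\<close>,
  every positive power is a multiple of \<open>K\<close> or of \<open>K ** K\<close>, and the
  coefficients form the sine and cosine series.\<close>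

lemma mat_exp_hat:
  fixes \<xi> :: "real^3"
  assumes "\<xi> \<noteq> 0"
  defines "\<theta> \<equiv> norm \<xi>" and "K \<equiv> hat \<xi>"
  shows "mat_exp (s *\<^sub>R hat \<xi>) =
    mat 1 + (sin (s * \<theta>) / \<theta>) *\<^sub>R K + ((1 - cos (s * \<theta>)) / \<theta>\<^sup>2) *\<^sub>R (K ** K)"
proof -
  \<comment> \<open>The power series coefficients of the constant 1, from which the cosine series is
    subtracted.\<close>
  let ?d = "\<lambda>n::nat. if n = 0 then 1 else 0 :: real"
  have \<theta>: "\<theta> \<noteq> 0" "\<theta>\<^sup>2 = \<xi> \<bullet> \<xi>"
    using assms(1) by (simp_all add: \<theta>_def power2_norm_eq_inner)
  have cube: "K ** (K ** K) = - (\<theta>\<^sup>2) *\<^sub>R K"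
    unfolding K_def \<theta>(2) by (simp add: matrix3_simps) (intro conjI; algebra)
  have trm: "(1 / fact n) *\<^sub>R (((**) (s *\<^sub>R K)) ^^ n) (mat 1) =
      ?d n *\<^sub>R mat 1 + (sin_coeff n *\<^sub>R (s * \<theta>) ^ n / \<theta>) *\<^sub>R K
      + ((?d n - cos_coeff n *\<^sub>R (s * \<theta>) ^ n) / \<theta>\<^sup>2) *\<^sub>R (K ** K)" for n
  proof (induction n)
    case 0
    then show ?case by simp
  next
    case (Suc n)
    have "(1 / fact (Suc n)) *\<^sub>R (((**) (s *\<^sub>R K)) ^^ (Suc n)) (mat 1)
        = (s / real (Suc n)) *\<^sub>R (K ** ((1 / fact n) *\<^sub>R (((**) (s *\<^sub>R K)) ^^ n) (mat 1)))"
      by (simp add: matrix_mult_scaleR)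
    also have "\<dots> = (s / real (Suc n)) *\<^sub>R (?d n *\<^sub>R K
      + (sin_coeff n *\<^sub>R (s * \<theta>) ^ n / \<theta>) *\<^sub>R (K ** K)
      + ((?d n - cos_coeff n *\<^sub>R (s * \<theta>) ^ n) / \<theta>\<^sup>2) *\<^sub>R (- (\<theta>\<^sup>2) *\<^sub>R K))"
      unfolding Suc.IH matrix_add_ldistrib matrix_mult_scaleR cube matrix_mul_rid ..
    also have "\<dots> = ?d (Suc n) *\<^sub>R mat 1 + (sin_coeff (Suc n) *\<^sub>R (s * \<theta>) ^ Suc n / \<theta>) *\<^sub>R K
      + ((?d (Suc n) - cos_coeff (Suc n) *\<^sub>R (s * \<theta>) ^ Suc n) / \<theta>\<^sup>2) *\<^sub>R (K ** K)"
      using \<theta>(1)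
      by (simp add: vec_eq_iff sin_coeff_Suc cos_coeff_Suc divide_simps power2_eq_square)
        (simp add: algebra_simps)
    finally show ?case .
  qed
  have "(\<lambda>n. (1 / fact n) *\<^sub>R (((**) (s *\<^sub>R K)) ^^ n) (mat 1)) sums
      (1 *\<^sub>R mat 1 + (sin (s * \<theta>) / \<theta>) *\<^sub>R K + ((1 - cos (s * \<theta>)) / \<theta>\<^sup>2) *\<^sub>R (K ** K))"
    unfolding trm
    by (intro sums_add sums_scaleR_left sums_divide sums_diff sin_converges cos_converges
        sums_single[where i = 0 and f = "\<lambda>_. 1"])
  then show ?thesis
    unfolding mat_exp_def K_def[symmetric] by (simp add: sums_iff)
qed

text \<open>The half-angle formulas turn Rodrigues' formula into the Gibbs form. The assumption on
  the cosine excludes half turns, which have no Gibbs vector.\<close>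

lemma mat_exp_hat_eq_gibbs_rotation:
  assumes "\<xi> \<noteq> 0" "cos (s * norm \<xi> / 2) \<noteq> 0"
  shows "mat_exp (s *\<^sub>R hat \<xi>) = gibbs_rotation ((tan (s * norm \<xi> / 2) / norm \<xi>) *\<^sub>R \<xi>)"
proof -
  define \<theta> where "\<theta> = norm \<xi>"
  define t where "t = tan (s * \<theta> / 2)"
  have \<theta>: "\<theta> \<noteq> 0" "\<xi> \<bullet> \<xi> = \<theta>\<^sup>2"
    using assms(1) by (simp_all add: \<theta>_def power2_norm_eq_inner)
  have t: "1 + t\<^sup>2 \<noteq> 0"
    by (metis add_pos_nonneg less_irrefl zero_le_power2 zero_less_one)
  have "sin (2 * (s * \<theta> / 2)) = 2 * t / (1 + t\<^sup>2)"
    unfolding t_def by (rule sin_tan_half)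
  moreover have "cos (2 * (s * \<theta> / 2)) = (1 - t\<^sup>2) / (1 + t\<^sup>2)"
    using assms(2) unfolding t_def \<theta>_def by (rule cos_tan_half)
  ultimately have sc: "sin (s * \<theta>) = 2 * t / (1 + t\<^sup>2)" "1 - cos (s * \<theta>) = 2 * t\<^sup>2 / (1 + t\<^sup>2)"
    using t by (simp_all add: field_simps)
  have "gibbs_rotation ((t / \<theta>) *\<^sub>R \<xi>) = mat 1 + (2 * t / (1 + t\<^sup>2) / \<theta>) *\<^sub>R hat \<xi>
      + ((2 * t\<^sup>2 / (1 + t\<^sup>2)) / \<theta>\<^sup>2) *\<^sub>R (hat \<xi> ** hat \<xi>)"
  proof -
    have "((t / \<theta>) *\<^sub>R \<xi>) \<bullet> ((t / \<theta>) *\<^sub>R \<xi>) = t\<^sup>2"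
      using \<theta> by (simp add: power2_eq_square)
    then show ?thesis
      by (simp add: gibbs_rotation_eq hat_scaleR scaleR_add_right matrix_mult_scaleR
          power2_eq_square)
  qed
  then show ?thesis
    unfolding mat_exp_hat[OF assms(1)] \<theta>_def[symmetric] sc t_def[symmetric] by simp
qed

section \<open>The Legendre transformation in closed form\<close>

lemma discrete_Lagrangian_Cay:
  "\<epsilon> \<noteq> 0 \<Longrightarrow> discrete_Lagrangian I \<epsilon> (Cay \<epsilon> \<omega>) = \<epsilon> * reduced_Lagrangian I \<omega>"
  by (simp add: discrete_Lagrangian_def inv_f_f inj_Cay)

text \<open>The \<open>hat\<close> of this vector is
  \<open>(mat 1 + hat a) ** hat p ** (mat 1 - hat a)\<close>. It turns out to be the momentum of
  \<open>Cay \<epsilon> \<omega>\<close>.\<close>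

definition Legendre_vector :: "real^3^3 \<Rightarrow> real \<Rightarrow> real^3 \<Rightarrow> real^3" where
  "Legendre_vector I \<epsilon> \<omega> = (let a = (\<epsilon> / 2) *\<^sub>R \<omega>; p = I *v \<omega> in p + cross3 a p + (a \<bullet> p) *\<^sub>R a)"

lemma reduced_Lagrangian_has_real_derivative:
  assumes "transpose I = I" "(c has_vector_derivative v) (at s)"
  shows "((\<lambda>s. reduced_Lagrangian I (c s)) has_real_derivative (I *v c s) \<bullet> v) (at s)"
proof -
  have lin: "bounded_linear ((*v) I)"
    by (rule matrix_vector_mul_bounded_linear)
  have sym: "(I *v v) \<bullet> c s = (I *v c s) \<bullet> v"
    by (metis assms(1) dot_lmul_matrix inner_commute vector_transpose_matrix)
  have "((\<lambda>s. (I *v c s) \<bullet> c s / 2) has_vector_derivative ((I *v c s) \<bullet> v + (I *v v) \<bullet> c s) / 2) (at s)"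
    by (intro bounded_linear.has_vector_derivative[OF bounded_linear_divide]
        bounded_bilinear.has_vector_derivative[OF bounded_bilinear_inner]
        bounded_linear.has_vector_derivative[OF lin] assms(2))
  then show ?thesis
    by (simp add: sym reduced_Lagrangian_def has_real_derivative_iff_has_vector_derivative)
qed

text \<open>For small \<open>s\<close> the curve stays in the range of the Cayley map: composing
  Gibbs vectors gives \<open>Cay \<epsilon> (c s)\<close> for an explicit curve \<open>c\<close>
  through \<open>\<omega>\<close>. The claim is then the chain rule for the reduced Lagrangian along
  \<open>c\<close>.\<close>

lemma discrete_Lagrangian_has_real_derivative:
  assumes I: "transpose I = I" and \<epsilon>: "\<epsilon> \<noteq> 0"
  shows "((\<lambda>s. discrete_Lagrangian I \<epsilon> (mat_exp (s *\<^sub>R hat \<xi>) ** Cay \<epsilon> \<omega>))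
    has_real_derivative Legendre_vector I \<epsilon> \<omega> \<bullet> \<xi>) (at 0)"
proof (cases "\<xi> = 0")
  \<comment> \<open>The formula for the exponential divides by \<open>norm \<xi>\<close>. Here the
    curve is constant.\<close>
  case True
  have "hat 0 = 0"
    by (simp add: matrix3_simps)
  then show ?thesis
    using True by simp
next
  case False
  define \<theta> where "\<theta> = norm \<xi>"
  define a where "a = (\<epsilon> / 2) *\<^sub>R \<omega>"
  define p where "p = I *v \<omega>"
  \<comment> \<open>The Gibbs vector of the exponential is \<open>\<xi>\<close> scaled by
    \<open>t s\<close>, and \<open>d s\<close> is the denominator of the composition formula. The
    factor \<open>2 / \<epsilon>\<close> in \<open>c\<close> undoes the scaling inside
    \<open>Cay\<close>.\<close>
  define t where "t s = tan (s * \<theta> / 2) / \<theta>" for s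
  define d where "d s = 1 - t s * (\<xi> \<bullet> a)" for s
  define c where "c s = (2 / \<epsilon>) *\<^sub>R ((1 / d s) *\<^sub>R (a + t s *\<^sub>R (\<xi> + cross3 \<xi> a)))" for s
  have \<theta>: "\<theta> \<noteq> 0"
    using False by (simp add: \<theta>_def)
  have t0: "t 0 = 0"
    by (simp add: t_def)
  have dt: "(t has_real_derivative 1 / 2) (at 0)"
    unfolding t_def using \<theta> by (auto intro!: derivative_eq_intros)
  have dd: "((\<lambda>s. 1 / d s) has_real_derivative (\<xi> \<bullet> a) / 2) (at 0)"
    unfolding d_def using t0 by (auto intro!: derivative_eq_intros dt)
  have dc: "(c has_vector_derivative (2 / \<epsilon>) *\<^sub>R ((1 / 2) *\<^sub>R (\<xi> + cross3 \<xi> a + (\<xi> \<bullet> a) *\<^sub>R a))) (at 0)"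
  proof -
    have "((\<lambda>s. a + t s *\<^sub>R (\<xi> + cross3 \<xi> a)) has_vector_derivative (1 / 2) *\<^sub>R (\<xi> + cross3 \<xi> a)) (at 0)"
      by (rule derivative_eq_intros dt refl)+ simp
    from has_vector_derivative_scaleR[OF dd this]
    have "((\<lambda>s. (1 / d s) *\<^sub>R (a + t s *\<^sub>R (\<xi> + cross3 \<xi> a))) has_vector_derivative
        (1 / 2) *\<^sub>R (\<xi> + cross3 \<xi> a + (\<xi> \<bullet> a) *\<^sub>R a)) (at 0)"
      by (simp add: t0 d_def scaleR_add_right)
    then show ?thesis
      unfolding c_def by (rule bounded_linear.has_vector_derivative[OF bounded_linear_scaleR_right])
  qed
  have c0: "c 0 = \<omega>"
    using \<epsilon> by (simp add: c_def d_def t0 a_def)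
  have "((\<lambda>s. \<epsilon> * reduced_Lagrangian I (c s)) has_real_derivative
      \<epsilon> * (p \<bullet> ((2 / \<epsilon>) *\<^sub>R ((1 / 2) *\<^sub>R (\<xi> + cross3 \<xi> a + (\<xi> \<bullet> a) *\<^sub>R a))))) (at 0)"
    using DERIV_cmult[OF reduced_Lagrangian_has_real_derivative[OF I dc], of \<epsilon>]
    by (simp add: c0 p_def)
  also have "\<epsilon> * (p \<bullet> ((2 / \<epsilon>) *\<^sub>R ((1 / 2) *\<^sub>R (\<xi> + cross3 \<xi> a + (\<xi> \<bullet> a) *\<^sub>R a))))
      = p \<bullet> (\<xi> + cross3 \<xi> a + (\<xi> \<bullet> a) *\<^sub>R a)"
    using \<epsilon> by simp
  \<comment> \<open>Cyclic symmetry of the triple product moves \<open>a\<close> over to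
    \<open>p\<close>.\<close>
  also have "\<dots> = Legendre_vector I \<epsilon> \<omega> \<bullet> \<xi>"
    unfolding Legendre_vector_def Let_def a_def[symmetric] p_def[symmetric]
    by (simp add: matrix3_simps algebra_simps)
  finally have der: "((\<lambda>s. \<epsilon> * reduced_Lagrangian I (c s)) has_real_derivative
      Legendre_vector I \<epsilon> \<omega> \<bullet> \<xi>) (at 0)" .
  \<comment> \<open>The derivative at 0 depends on small \<open>s\<close> only, where neither the
    half-angle cosine nor the denominator vanishes.\<close>
  have ev: "\<forall>\<^sub>F s in nhds 0. cos (s * \<theta> / 2) \<noteq> 0 \<and> d s \<noteq> 0"
  proof (rule eventually_conj)
    have "isCont d 0"
      unfolding d_def using DERIV_isCont[OF dt] by (intro continuous_intros)
    then have "(d \<longlongrightarrow> d 0) (nhds 0)"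
      by (simp only: isCont_def tendsto_at_iff_tendsto_nhds)
    then show "\<forall>\<^sub>F s in nhds 0. d s \<noteq> 0"
      by (rule tendsto_imp_eventually_ne) (simp add: d_def t0)
    have "isCont (\<lambda>s. cos (s * \<theta> / 2)) 0"
      by (intro continuous_intros) auto
    then have "((\<lambda>s. cos (s * \<theta> / 2)) \<longlongrightarrow> cos (0 * \<theta> / 2)) (nhds 0)"
      unfolding isCont_def
      using tendsto_at_iff_tendsto_nhds[of "\<lambda>s. cos (s * \<theta> / 2)" 0] by blast
    then show "\<forall>\<^sub>F s in nhds 0. cos (s * \<theta> / 2) \<noteq> 0"
      by (rule tendsto_imp_eventually_ne) simp
  qed
  have "discrete_Lagrangian I \<epsilon> (mat_exp (s *\<^sub>R hat \<xi>) ** Cay \<epsilon> \<omega>) = \<epsilon> * reduced_Lagrangian I (c s)"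
    if "cos (s * \<theta> / 2) \<noteq> 0 \<and> d s \<noteq> 0" for s
  proof -
    have "mat_exp (s *\<^sub>R hat \<xi>) = gibbs_rotation (t s *\<^sub>R \<xi>)"
      using mat_exp_hat_eq_gibbs_rotation[OF False] that by (simp add: \<theta>_def t_def)
    moreover have "(t s *\<^sub>R \<xi>) \<bullet> a \<noteq> 1"
      using that by (simp add: d_def)
    ultimately have "mat_exp (s *\<^sub>R hat \<xi>) ** Cay \<epsilon> \<omega>
      = gibbs_rotation ((1 / d s) *\<^sub>R (t s *\<^sub>R \<xi> + a + cross3 (t s *\<^sub>R \<xi>) a))"
      by (simp add: Cay_eq_gibbs_rotation a_def[symmetric] gibbs_rotation_mult d_def)
    also have "\<dots> = Cay \<epsilon> (c s)"
      using \<epsilon> by (simp add: c_def Cay_eq_gibbs_rotation cross_mult_left scaleR_add_right add_ac)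
    finally show ?thesis
      using \<epsilon> by (simp add: discrete_Lagrangian_Cay)
  qed
  then show ?thesis
    using der ev by (subst DERIV_cong_ev[OF refl _ refl]) (auto elim: eventually_mono)
qed

text \<open>Derivatives are unique and a vector is determined by its inner products, so the definite
  description has exactly one solution.\<close>

lemma discrete_Legendre_Cay:
  assumes "transpose I = I" "\<epsilon> \<noteq> 0"
  shows "discrete_Legendre I \<epsilon> (Cay \<epsilon> \<omega>) = Legendre_vector I \<epsilon> \<omega>"
  unfolding discrete_Legendre_def so3_pairing_hat
proof (rule the_equality)
  fix M
  assume "\<forall>\<xi>. ((\<lambda>s. discrete_Lagrangian I \<epsilon> (mat_exp (s *\<^sub>R hat \<xi>) ** Cay \<epsilon> \<omega>))
    has_real_derivative M \<bullet> \<xi>) (at 0)"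
  then have "M \<bullet> \<xi> = Legendre_vector I \<epsilon> \<omega> \<bullet> \<xi>" for \<xi>
    using DERIV_unique discrete_Lagrangian_has_real_derivative[OF assms] by blast
  then show "M = Legendre_vector I \<epsilon> \<omega>"
    using vector_eq_rdot by blast
qed (use discrete_Lagrangian_has_real_derivative[OF assms] in blast)

section \<open>The discrete equations in the coordinates (u, v)\<close>

text \<open>The Cayley relation \<open>(mat 1 - hat a) ** gibbs_rotation a = mat 1 + hat a\<close>
  and its transpose exchange the outer factors of
  \<open>(mat 1 + hat a) ** hat p ** (mat 1 - hat a)\<close>. Conjugating the momentum thus reverses
  the sign of the time step.\<close>

lemma transpose_gibbs_rotation_hat:
  "transpose (gibbs_rotation a) ** hat (p + cross3 a p + (a \<bullet> p) *\<^sub>R a) ** gibbs_rotation a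
    = hat (p - cross3 a p + (a \<bullet> p) *\<^sub>R a)"
proof -
  let ?R = "gibbs_rotation a" and ?A = "mat 1 + hat a" and ?B = "mat 1 - hat a"
  have hat_conj: "(mat 1 + hat a) ** hat p ** (mat 1 - hat a)
      = hat (p + cross3 a p + (a \<bullet> p) *\<^sub>R a)" for a
    by (simp add: matrix3_simps) (intro conjI; algebra)
  have "?B ** quat_matrix 1 a = (1 + a \<bullet> a) *\<^sub>R ?A"
    by (simp add: matrix3_simps quat_matrix_def) (intro conjI; algebra)
  then have BR: "?B ** ?R = ?A"
    using one_plus_inner_pos[of a] by (simp add: gibbs_rotation_def matrix_mult_scaleR)
  have "transpose ?R ** ?A = transpose (?B ** ?R)"
    by (simp only: matrix_transpose_mul) (simp add: matrix3_simps)
  also have "\<dots> = ?B"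
    unfolding BR by (simp add: matrix3_simps)
  finally have RA: "transpose ?R ** ?A = ?B" .
  have "transpose ?R ** (?A ** hat p ** ?B) ** ?R = (transpose ?R ** ?A) ** hat p ** (?B ** ?R)"
    by (simp only: matrix_mul_assoc)
  also have "\<dots> = ?B ** hat p ** ?A"
    by (simp only: BR RA)
  also have "\<dots> = hat (p - cross3 a p + (a \<bullet> p) *\<^sub>R a)"
    using hat_conj[of "- a"] hat_scaleR[of "-1" a] by (simp add: cross_minus_left)
  finally show ?thesis
    by (simp only: hat_conj)
qed

text \<open>The functions of the discrete equations are components of \<open>plane_Legendre\<close>: the pair
  \<open>(p\<^sub>3\<^sup>+, q\<^sub>3\<^sup>-)\<close> for the step \<open>\<epsilon>\<close>, and \<open>(p\<^sub>3\<^sup>-, q\<^sub>3\<^sup>+)\<close> for the step \<open>-\<epsilon>\<close>.\<close>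

definition plane_Legendre :: "real^3^3 \<Rightarrow> real \<Rightarrow> real \<times> real \<Rightarrow> real \<times> real" where
  "plane_Legendre I \<epsilon> = (\<lambda>(u, v).
     (I $ 1 $ 1 * u + \<epsilon> / 2 * v * (I $ 1 $ 3 * u + I $ 2 $ 3 * v)
        + \<epsilon>\<^sup>2 / 4 * u * (I $ 1 $ 1 * u\<^sup>2 + I $ 2 $ 2 * v\<^sup>2),
      I $ 2 $ 2 * v - \<epsilon> / 2 * u * (I $ 1 $ 3 * u + I $ 2 $ 3 * v)
        + \<epsilon>\<^sup>2 / 4 * v * (I $ 1 $ 1 * u\<^sup>2 + I $ 2 $ 2 * v\<^sup>2)))"

lemma inertia_entries:
  assumes "inertia_tensor I" "I $ 1 $ 2 = 0"
  shows "transpose I = I" "I $ 2 $ 1 = 0" "I $ 3 $ 1 = I $ 1 $ 3" "I $ 3 $ 2 = I $ 2 $ 3"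
    "0 < I $ 1 $ 1" "0 < I $ 2 $ 2"
proof -
  show tr: "transpose I = I"
    using assms(1) by (simp add: inertia_tensor_def)
  have sym: "I $ i $ j = I $ j $ i" for i j
    using arg_cong[OF tr, of "\<lambda>A. A $ i $ j"] by (simp add: transpose_def)
  show "I $ 2 $ 1 = 0" "I $ 3 $ 1 = I $ 1 $ 3" "I $ 3 $ 2 = I $ 2 $ 3"
    using assms(2) sym[of 2 1] sym[of 3 1] sym[of 3 2] by simp_all
  have "0 < I $ i $ i" for i
  proof -
    have "0 < (I *v axis i 1) \<bullet> axis i 1"
      using assms(1) by (simp add: inertia_tensor_def axis_eq_0_iff)
    then show ?thesis
      by (simp add: inner_axis matrix_vector_mult_basis column_def)
  qed
  then show "0 < I $ 1 $ 1" "0 < I $ 2 $ 2"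
    by auto
qed

lemma Legendre_vector_components:
  assumes "inertia_tensor I" "I $ 1 $ 2 = 0"
  shows "(Legendre_vector I \<epsilon> (vector [u, v, 0]) $ 1, Legendre_vector I \<epsilon> (vector [u, v, 0]) $ 2)
    = plane_Legendre I \<epsilon> (u, v)"
  using inertia_entries[OF assms] assms(2)
  by (simp add: Legendre_vector_def plane_Legendre_def Let_def matrix_vector_mult_def sum_3
      inner_vec_def cross_components power2_eq_square algebra_simps)

lemma plane_momentum_eq:
  assumes "inertia_tensor I" "I $ 1 $ 2 = 0" "\<epsilon> \<noteq> 0"
  shows "plane_momentum I \<epsilon> x = plane_Legendre I \<epsilon> x"
  using Legendre_vector_components[OF assms(1,2), of \<epsilon> "fst x" "snd x"]
  by (simp add: plane_momentum_def Cay_chart_def Let_def assms(3)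
      discrete_Legendre_Cay[OF inertia_entries(1)[OF assms(1,2)]])

text \<open>Conjugation by \<open>Cay_chart \<epsilon> x\<close> turns the Legendre vector of
  \<open>x\<close> into the one for \<open>- \<epsilon>\<close>. The multiplier absorbs the third
  component, which leaves the first two as equations.\<close>

lemma discrete_EPS_iff:
  assumes "inertia_tensor I" "I $ 1 $ 2 = 0" "\<epsilon> \<noteq> 0"
  shows "discrete_EPS I \<epsilon> (Cay_chart \<epsilon> x) (Cay_chart \<epsilon> y)
    \<longleftrightarrow> plane_Legendre I \<epsilon> y = plane_Legendre I (- \<epsilon>) x"
proof -
  let ?w = "\<lambda>x. vector [fst x, snd x, 0] :: real^3"
  let ?M = "Legendre_vector I \<epsilon> (?w y)" and ?N = "Legendre_vector I (- \<epsilon>) (?w x)"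
  have chart: "Cay_chart \<epsilon> z \<in> discrete_constraint \<epsilon>"
    "discrete_Legendre I \<epsilon> (Cay_chart \<epsilon> z) = Legendre_vector I \<epsilon> (?w z)" for z
    by (auto simp: discrete_constraint_def constraint_space_def Cay_chart_def assms(3)
      discrete_Legendre_Cay[OF inertia_entries(1)[OF assms(1,2)]])
  have "transpose (Cay_chart \<epsilon> x) ** hat (Legendre_vector I \<epsilon> (?w x)) ** Cay_chart \<epsilon> x = hat ?N"
    using transpose_gibbs_rotation_hat[of "(\<epsilon> / 2) *\<^sub>R ?w x" "I *v ?w x"]
    by (simp add: Cay_chart_def Cay_eq_gibbs_rotation Legendre_vector_def Let_def cross_minus_left)
  moreover have "Legendre_vector I \<epsilon> (?w z) \<in> momentum_locus I \<epsilon>" for z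
    unfolding momentum_locus_def using chart by (metis imageI)
  ultimately have "discrete_EPS I \<epsilon> (Cay_chart \<epsilon> x) (Cay_chart \<epsilon> y)
      \<longleftrightarrow> (\<exists>\<mu>. hat ?M = hat ?N + \<mu> *\<^sub>R hat (vector [0, 0, 1]))"
    using chart by (simp add: discrete_EPS_def)
  also have "\<dots> \<longleftrightarrow> (\<exists>\<mu>. ?M $ 1 = ?N $ 1 \<and> ?M $ 2 = ?N $ 2 \<and> ?M $ 3 = ?N $ 3 + \<mu>)"
    by (rule ex_cong1) (auto simp: vec_eq_iff forall_3 hat_components)
  also have "\<dots> \<longleftrightarrow> ?M $ 1 = ?N $ 1 \<and> ?M $ 2 = ?N $ 2"
    by (metis add.commute diff_add_cancel)
  also have "\<dots> \<longleftrightarrow> plane_Legendre I \<epsilon> y = plane_Legendre I (- \<epsilon>) x"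
    using Legendre_vector_components[OF assms(1,2), of \<epsilon> "fst y" "snd y"]
      Legendre_vector_components[OF assms(1,2), of "- \<epsilon>" "fst x" "snd x"]
    by (metis prod.collapse prod.inject)
  finally show ?thesis .
qed

section \<open>Second-order expansions\<close>

lemma at_right_0_bigo_1:
  assumes "(f \<longlongrightarrow> (c::real)) (at_right (0::real))"
  shows "f \<in> O[at_right 0](\<lambda>t. 1)"
  using assms by (intro bigoI_tendsto[where c = c]) simp_all

lemma bigo_cmult:
  fixes f h :: "real \<Rightarrow> real"
  shows "f \<in> O[F](h) \<Longrightarrow> (\<lambda>t. c * f t) \<in> O[F](h)"
  by (cases "c = 0") simp_all

lemma bigo_mult_cong:
  fixes f g p q h :: "real \<Rightarrow> real"
  assumes "f \<in> O[F](\<lambda>_. 1)" "q \<in> O[F](\<lambda>_. 1)"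
    and "(\<lambda>t. f t - p t) \<in> O[F](h)" "(\<lambda>t. g t - q t) \<in> O[F](h)"
  shows "(\<lambda>t. f t * g t - p t * q t) \<in> O[F](h)"
proof -
  have "(\<lambda>t. f t * (g t - q t) + (f t - p t) * q t) \<in> O[F](h)"
    using landau_o.big.mult[OF assms(1,4)] landau_o.big.mult[OF assms(3,2)]
    by (intro sum_in_bigo) simp_all
  then show ?thesis
    by (simp add: algebra_simps)
qed

definition quad :: "real \<Rightarrow> real \<Rightarrow> real \<Rightarrow> real \<Rightarrow> real \<Rightarrow> real" where
  "quad a b c u v = a * u\<^sup>2 + b * (u * v) + c * v\<^sup>2"

text \<open>The differential of \<open>quad a b c\<close> at (u, v), applied to (x, y).\<close>

definition quad_deriv :: "real \<Rightarrow> real \<Rightarrow> real \<Rightarrow> real \<Rightarrow> real \<Rightarrow> real \<Rightarrow> real \<Rightarrow> real" where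
  "quad_deriv a b c u v x y = 2 * a * (u * x) + b * (u * y + x * v) + 2 * c * (v * y)"

lemma quad_deriv_scale: "quad_deriv a b c u v (r * x) (r * y) = r * quad_deriv a b c u v x y"
  by (simp add: quad_deriv_def algebra_simps)

lemma quad_bigo_cong:
  fixes f g p q h :: "real \<Rightarrow> real"
  assumes "f \<in> O[F](\<lambda>_. 1)" "g \<in> O[F](\<lambda>_. 1)" "p \<in> O[F](\<lambda>_. 1)" "q \<in> O[F](\<lambda>_. 1)"
    and "(\<lambda>t. f t - p t) \<in> O[F](h)" "(\<lambda>t. g t - q t) \<in> O[F](h)"
  shows "(\<lambda>t. quad a b c (f t) (g t) - quad a b c (p t) (q t)) \<in> O[F](h)"
proof -
  have "(\<lambda>t. a * (f t * f t - p t * p t) + b * (f t * g t - p t * q t)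
      + c * (g t * g t - q t * q t)) \<in> O[F](h)"
    by (intro sum_in_bigo bigo_cmult bigo_mult_cong assms)
  then show ?thesis
    by (simp add: quad_def power2_eq_square algebra_simps)
qed

lemma quad_bigo_1:
  fixes f g :: "real \<Rightarrow> real"
  assumes "f \<in> O[F](\<lambda>_. 1)" "g \<in> O[F](\<lambda>_. 1)"
  shows "(\<lambda>t. quad a b c (f t) (g t)) \<in> O[F](\<lambda>_. 1)"
proof -
  have mult: "(\<lambda>t. h t * k t) \<in> O[F](\<lambda>_. 1)"
    if "h \<in> O[F](\<lambda>_. 1)" "k \<in> O[F](\<lambda>_. 1)" for h k :: "real \<Rightarrow> real"
    using landau_o.big.mult[OF that] by simp
  show ?thesis
    unfolding quad_def power2_eq_square by (intro sum_in_bigo bigo_cmult mult assms)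
qed

text \<open>On the straight line the remainder is exactly \<open>quad a b c x y * t ^ 2\<close>.
  Replacing the line by bounded functions that differ from it by O(t^2) changes the form by
  O(t^2).\<close>

lemma quad_expansion:
  fixes f g :: "real \<Rightarrow> real"
  assumes "(\<lambda>t. f t - (u + t * x)) \<in> O[at_right 0](\<lambda>t. t ^ 2)"
    and "(\<lambda>t. g t - (v + t * y)) \<in> O[at_right 0](\<lambda>t. t ^ 2)"
    and "f \<in> O[at_right 0](\<lambda>_. 1)" "g \<in> O[at_right 0](\<lambda>_. 1)"
  shows "(\<lambda>t. quad a b c (f t) (g t) - (quad a b c u v + t * quad_deriv a b c u v x y))
    \<in> O[at_right 0](\<lambda>t. t ^ 2)"
proof -
  have bd: "(\<lambda>t. w + t * z) \<in> O[at_right 0](\<lambda>_. 1)" for w z :: real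
    by (rule at_right_0_bigo_1[where c = "w + 0 * z"]) (intro tendsto_intros)
  have "(\<lambda>t. quad a b c (f t) (g t) - quad a b c (u + t * x) (v + t * y))
      \<in> O[at_right 0](\<lambda>t. t ^ 2)"
    by (intro quad_bigo_cong assms bd)
  moreover have "(\<lambda>t. quad a b c x y * t ^ 2) \<in> O[at_right 0](\<lambda>t. t ^ 2)"
    by simp
  ultimately have "(\<lambda>t. quad a b c (f t) (g t) - quad a b c (u + t * x) (v + t * y)
      + quad a b c x y * t ^ 2) \<in> O[at_right 0](\<lambda>t. t ^ 2)"
    by (rule sum_in_bigo(1))
  then show ?thesis
    by (simp add: quad_def quad_deriv_def power2_eq_square algebra_simps)
qed

section \<open>Expansion of the continuous flow\<close>

text \<open>By the mean value theorem the increment is \<open>t\<close> times \<open>f' s\<close>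
  with 0 < s < t, and \<open>s ^ n \<le> t ^ n\<close>, so one power of \<open>t\<close> is gained.
  Derivatives are one-sided at 0 because solutions are given forward in time.\<close>

lemma bigo_integrate:
  fixes f f' :: "real \<Rightarrow> real"
  assumes "0 < T" and der: "\<And>t. t \<in> {0..<T} \<Longrightarrow> (f has_real_derivative f' t) (at t within {0..<T})"
    and "f' \<in> O[at_right 0](\<lambda>t. t ^ n)"
  shows "(\<lambda>t. f t - f 0) \<in> O[at_right 0](\<lambda>t. t ^ Suc n)"
proof -
  obtain c where c: "c > 0" "\<forall>\<^sub>F t in at_right 0. norm (f' t) \<le> c * norm (t ^ n)"
    using assms(3) by (elim landau_o.bigE)
  then obtain b where b: "0 < b" "\<And>t. 0 < t \<Longrightarrow> t < b \<Longrightarrow> \<bar>f' t\<bar> \<le> c * \<bar>t ^ n\<bar>"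
    unfolding eventually_at_right_field by auto
  have "norm (f t - f 0) \<le> c * norm (t ^ Suc n)" if t: "0 < t" "t < min b T" for t
  proof -
    have "(f has_derivative (*) (f' s)) (at s within {0..t})" if "0 \<le> s" "s \<le> t" for s
      using der[of s] that t
      by (auto simp: has_field_derivative_def intro: has_derivative_subset)
    then obtain s where s: "s \<in> {0<..<t}" "f t - f 0 = f' s * (t - 0)"
      using mvt_simple[of 0 t f "\<lambda>s. (*) (f' s)", OF t(1)] by blast
    have "\<bar>f' s\<bar> \<le> c * t ^ n"
      using b(2)[of s] s(1) t c(1) power_mono[of s t n]
      by (smt (verit, best) greaterThanLessThan_iff mult_left_mono power_abs zero_le_power)
    then show ?thesis
      using s(2) t by (simp add: abs_mult power_abs mult.commute mult_left_mono mult.left_commute)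
  qed
  then have "\<forall>\<^sub>F t in at_right 0. norm (f t - f 0) \<le> c * norm (t ^ Suc n)"
    unfolding eventually_at_right_field using b(1) assms(1) by (intro exI[of _ "min b T"]) auto
  then show ?thesis
    by (rule bigoI)
qed

text \<open>Three integrations: bounded right-hand sides give the solution up to O(t), this gives it
  up to O(t^2), and the first-order expansion of the right-hand sides gives it up to O(t^3). As
  \<open>x\<close> and \<open>y\<close> are the initial velocities of the rescaled components,
  \<open>quad_deriv\<close> is the initial second derivative.\<close>

lemma quad_flow_expansion:
  fixes M1 M2 :: "real \<Rightarrow> real"
  assumes "0 < T" and pos: "\<alpha> \<noteq> 0" "\<beta> \<noteq> 0"
    and d1: "\<And>t. t \<in> {0..<T} \<Longrightarrow>
      (M1 has_real_derivative quad a b c (M1 t / \<alpha>) (M2 t / \<beta>)) (at t within {0..<T})"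
    and d2: "\<And>t. t \<in> {0..<T} \<Longrightarrow>
      (M2 has_real_derivative quad a' b' c' (M1 t / \<alpha>) (M2 t / \<beta>)) (at t within {0..<T})"
  defines "u \<equiv> M1 0 / \<alpha>" and "v \<equiv> M2 0 / \<beta>"
  defines "x \<equiv> quad a b c u v / \<alpha>" and "y \<equiv> quad a' b' c' u v / \<beta>"
  shows "(\<lambda>t. M1 t - (M1 0 + t * quad a b c u v + t\<^sup>2 / 2 * quad_deriv a b c u v x y))
      \<in> O[at_right 0](\<lambda>t. t ^ 3)"
    and "(\<lambda>t. M2 t - (M2 0 + t * quad a' b' c' u v + t\<^sup>2 / 2 * quad_deriv a' b' c' u v x y))
      \<in> O[at_right 0](\<lambda>t. t ^ 3)"
proof -
  let ?k = "quad a b c" and ?l = "quad a' b' c'"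
  let ?U = "\<lambda>t. M1 t / \<alpha>" and ?V = "\<lambda>t. M2 t / \<beta>"
  have lim: "(f \<longlongrightarrow> f 0) (at_right 0)"
    if "(f has_real_derivative D) (at 0 within {0..<T})" for f :: "real \<Rightarrow> real" and D
  proof -
    have "(f \<longlongrightarrow> f 0) (at 0 within {0..T / 2})"
      using DERIV_continuous[OF that] unfolding continuous_within
      by (rule tendsto_within_subset) (use assms(1) in auto)
    then show ?thesis
      using assms(1) by (simp add: at_within_Icc_at_right)
  qed
  have U1: "?U \<in> O[at_right 0](\<lambda>_. 1)" "?V \<in> O[at_right 0](\<lambda>_. 1)"
    using at_right_0_bigo_1[OF tendsto_divide[OF lim[OF d1] tendsto_const pos(1)]]
      at_right_0_bigo_1[OF tendsto_divide[OF lim[OF d2] tendsto_const pos(2)]] assms(1)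
    by simp_all
  have const: "(\<lambda>t. w) \<in> O[at_right 0](\<lambda>_. 1)" for w :: real
    by simp
  have rescale: "(\<lambda>t. f t / r - g t / r) \<in> O[at_right 0](h)"
    if "(\<lambda>t. f t - g t) \<in> O[at_right 0](h)" for f g h :: "real \<Rightarrow> real" and r
    using bigo_cmult[OF that, of "inverse r"] by (simp add: right_diff_distrib divide_inverse_commute)
  have k0: "(\<lambda>t. quad p q r (?U t) (?V t)) \<in> O[at_right 0](\<lambda>t. t ^ 0)" for p q r
    using quad_bigo_1[OF U1] by simp
  have U2: "(\<lambda>t. ?U t - u) \<in> O[at_right 0](\<lambda>t. t ^ 1)" "(\<lambda>t. ?V t - v) \<in> O[at_right 0](\<lambda>t. t ^ 1)"
    using rescale[OF bigo_integrate[OF assms(1) d1 k0], of \<alpha>]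
      rescale[OF bigo_integrate[OF assms(1) d2 k0], of \<beta>]
    by (simp_all add: u_def v_def)
  have k1: "(\<lambda>t. quad p q r (?U t) (?V t) - quad p q r u v) \<in> O[at_right 0](\<lambda>t. t ^ 1)" for p q r
    by (intro quad_bigo_cong U1 U2 const)
  have step1: "(\<lambda>t. f t - (f 0 + t * w)) \<in> O[at_right 0](\<lambda>t. t ^ 2)"
    if der: "\<And>t. t \<in> {0..<T} \<Longrightarrow> (f has_real_derivative f' t) (at t within {0..<T})"
      and bnd: "(\<lambda>t. f' t - w) \<in> O[at_right 0](\<lambda>t. t ^ 1)" for f f' :: "real \<Rightarrow> real" and w
  proof -
    have "((\<lambda>t. f t - t * w) has_real_derivative f' t - w) (at t within {0..<T})" if "t \<in> {0..<T}" for t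
      using der[OF that] by (auto intro!: derivative_eq_intros simp: field_simps)
    from bigo_integrate[OF assms(1) this bnd] show ?thesis
      by (simp add: algebra_simps numeral_2_eq_2)
  qed
  have step2: "(\<lambda>t. f t - (f 0 + t * w + t\<^sup>2 / 2 * z)) \<in> O[at_right 0](\<lambda>t. t ^ 3)"
    if der: "\<And>t. t \<in> {0..<T} \<Longrightarrow> (f has_real_derivative f' t) (at t within {0..<T})"
      and bnd: "(\<lambda>t. f' t - (w + t * z)) \<in> O[at_right 0](\<lambda>t. t ^ 2)" for f f' :: "real \<Rightarrow> real" and w z
  proof -
    have "((\<lambda>t. f t - (t * w + t\<^sup>2 / 2 * z)) has_real_derivative f' t - (w + t * z)) (at t within {0..<T})"
      if "t \<in> {0..<T}" for t
      using der[OF that] by (auto intro!: derivative_eq_intros simp: field_simps)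
    from bigo_integrate[OF assms(1) this bnd] show ?thesis
      by (simp add: algebra_simps numeral_3_eq_3)
  qed
  have U3: "(\<lambda>t. ?U t - (u + t * x)) \<in> O[at_right 0](\<lambda>t. t ^ 2)"
    "(\<lambda>t. ?V t - (v + t * y)) \<in> O[at_right 0](\<lambda>t. t ^ 2)"
    using rescale[OF step1[OF d1 k1], of \<alpha>] rescale[OF step1[OF d2 k1], of \<beta>]
    by (simp_all add: u_def v_def x_def y_def add_divide_distrib)
  show "(\<lambda>t. M1 t - (M1 0 + t * ?k u v + t\<^sup>2 / 2 * quad_deriv a b c u v x y))
      \<in> O[at_right 0](\<lambda>t. t ^ 3)"
    by (rule step2[OF d1 quad_expansion[OF U3 U1]])
  show "(\<lambda>t. M2 t - (M2 0 + t * ?l u v + t\<^sup>2 / 2 * quad_deriv a' b' c' u v x y))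
      \<in> O[at_right 0](\<lambda>t. t ^ 3)"
    by (rule step2[OF d2 quad_expansion[OF U3 U1]])
qed

section \<open>Expansion of the discrete scheme\<close>

text \<open>From mere convergence the implicit equations give \<open>f\<close> and \<open>g\<close>
  up to O(t); inserted once more they give \<open>u + t * (x / 2)\<close> and
  \<open>v + t * (y / 2)\<close> up to O(t^2). These half steps produce the same factor 1/2 in the
  second-order term as the Taylor expansion of the flow. The coefficients \<open>k\<close>,
  \<open>l\<close>, \<open>m\<close> stay free so that both components are covered.\<close>

lemma quad_scheme_expansion:
  fixes f g r s :: "real \<Rightarrow> real"
  assumes "\<alpha> \<noteq> 0" "\<beta> \<noteq> 0"
    and lim: "(f \<longlongrightarrow> u) (at_right 0)" "(g \<longlongrightarrow> v) (at_right 0)"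
    and rs: "r \<in> O[at_right 0](\<lambda>_. 1)" "s \<in> O[at_right 0](\<lambda>_. 1)"
    and ev: "\<forall>\<^sub>F t in at_right 0. \<alpha> * (f t - u) = t / 2 * quad a b c (f t) (g t) + t ^ 2 * r t"
      "\<forall>\<^sub>F t in at_right 0. \<beta> * (g t - v) = t / 2 * quad a' b' c' (f t) (g t) + t ^ 2 * s t"
  defines "x \<equiv> quad a b c u v / \<alpha>" and "y \<equiv> quad a' b' c' u v / \<beta>"
  shows "(\<lambda>t. t * quad k l m (f t) (g t)
      - (t * quad k l m u v + t\<^sup>2 / 2 * quad_deriv k l m u v x y)) \<in> O[at_right 0](\<lambda>t. t ^ 3)"
proof -
  have bd: "f \<in> O[at_right 0](\<lambda>_. 1)" "g \<in> O[at_right 0](\<lambda>_. 1)"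
    using lim at_right_0_bigo_1 by blast+
  have const: "(\<lambda>t. w) \<in> O[at_right 0](\<lambda>_. 1)" for w :: real
    by simp
  have t21: "(\<lambda>t. t ^ 2 * h t) \<in> O[at_right 0](\<lambda>t. t ^ 1)" "(\<lambda>t. t ^ 2 * h t) \<in> O[at_right 0](\<lambda>t. t ^ 2)"
    if "h \<in> O[at_right 0](\<lambda>_. 1)" for h :: "real \<Rightarrow> real"
  proof -
    have "(\<lambda>t::real. t) \<in> O[at_right 0](\<lambda>_. 1)"
      by (rule at_right_0_bigo_1[where c = 0]) (intro tendsto_intros)
    from landau_o.big.mult[OF landau_o.big_refl[of "\<lambda>t. t ^ 1"] landau_o.big.mult[OF this that]]
    show "(\<lambda>t. t ^ 2 * h t) \<in> O[at_right 0](\<lambda>t. t ^ 1)"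
      by (simp add: power2_eq_square mult.assoc)
    show "(\<lambda>t. t ^ 2 * h t) \<in> O[at_right 0](\<lambda>t. t ^ 2)"
      using landau_o.big.mult[OF landau_o.big_refl[of "\<lambda>t. t ^ 2"] that] by simp
  qed
  have step1: "(\<lambda>t. F t - w) \<in> O[at_right 0](\<lambda>t. t ^ 1)"
    if "\<gamma> \<noteq> 0" "h \<in> O[at_right 0](\<lambda>_. 1)"
      "\<forall>\<^sub>F t in at_right 0. \<gamma> * (F t - w) = t / 2 * quad p q p' (f t) (g t) + t ^ 2 * h t"
    for F h :: "real \<Rightarrow> real" and w \<gamma> p q p'
  proof -
    have "(\<lambda>t. quad p q p' (f t) (g t)) \<in> O[at_right 0](\<lambda>_. 1)"
      by (rule quad_bigo_1[OF bd])
    from landau_o.big.mult[OF landau_o.big_refl[of "\<lambda>t. t ^ 1"] this]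
    have "(\<lambda>t. t / 2 * quad p q p' (f t) (g t)) \<in> O[at_right 0](\<lambda>t. t ^ 1)"
      by simp
    then have "(\<lambda>t. t / 2 * quad p q p' (f t) (g t) + t ^ 2 * h t) \<in> O[at_right 0](\<lambda>t. t ^ 1)"
      using t21(1)[OF that(2)] by (rule sum_in_bigo(1))
    then have "(\<lambda>t. \<gamma> * (F t - w)) \<in> O[at_right 0](\<lambda>t. t ^ 1)"
      by (rule landau_o.big.in_cong[OF that(3), THEN iffD2])
    then show ?thesis
      using that(1) by simp
  qed
  note d1 = step1[OF assms(1) rs(1) ev(1)] step1[OF assms(2) rs(2) ev(2)]
  have step2: "(\<lambda>t. F t - (w + t * (quad p q p' u v / \<gamma> / 2))) \<in> O[at_right 0](\<lambda>t. t ^ 2)"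
    if "\<gamma> \<noteq> 0" "h \<in> O[at_right 0](\<lambda>_. 1)"
      "\<forall>\<^sub>F t in at_right 0. \<gamma> * (F t - w) = t / 2 * quad p q p' (f t) (g t) + t ^ 2 * h t"
    for F h :: "real \<Rightarrow> real" and w \<gamma> p q p'
  proof -
    have "(\<lambda>t. quad p q p' (f t) (g t) - quad p q p' u v) \<in> O[at_right 0](\<lambda>t. t ^ 1)"
      by (intro quad_bigo_cong bd d1 const)
    from landau_o.big.mult[OF landau_o.big_refl[of "\<lambda>t. t ^ 1"] this]
    have "(\<lambda>t. t / 2 * (quad p q p' (f t) (g t) - quad p q p' u v)) \<in> O[at_right 0](\<lambda>t. t ^ 2)"
      by (simp add: power2_eq_square)
    then have bigo: "(\<lambda>t. t / 2 * (quad p q p' (f t) (g t) - quad p q p' u v) + t ^ 2 * h t)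
        \<in> O[at_right 0](\<lambda>t. t ^ 2)"
      using t21(2)[OF that(2)] by (rule sum_in_bigo(1))
    have "\<forall>\<^sub>F t in at_right 0. \<gamma> * (F t - (w + t * (quad p q p' u v / \<gamma> / 2)))
        = t / 2 * (quad p q p' (f t) (g t) - quad p q p' u v) + t ^ 2 * h t"
      using that(3) by (rule eventually_mono) (use that(1) in \<open>simp add: field_simps\<close>)
    from landau_o.big.in_cong[OF this, THEN iffD2, OF bigo]
    have "(\<lambda>t. \<gamma> * (F t - (w + t * (quad p q p' u v / \<gamma> / 2)))) \<in> O[at_right 0](\<lambda>t. t ^ 2)" .
    then show ?thesis
      using that(1) by simp
  qed
  have "(\<lambda>t. quad k l m (f t) (g t) - (quad k l m u v + t * quad_deriv k l m u v (x / 2) (y / 2)))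
      \<in> O[at_right 0](\<lambda>t. t ^ 2)"
    unfolding x_def y_def
    by (intro quad_expansion bd step2[OF assms(1) rs(1) ev(1)] step2[OF assms(2) rs(2) ev(2)])
  from landau_o.big.mult[OF landau_o.big_refl[of "\<lambda>t. t ^ 1"] this]
  have "(\<lambda>t. t * (quad k l m (f t) (g t) - (quad k l m u v + t * quad_deriv k l m u v (x / 2) (y / 2))))
      \<in> O[at_right 0](\<lambda>t. t ^ 3)"
    by (simp add: power3_eq_cube power2_eq_square mult.assoc)
  moreover have "quad_deriv k l m u v (x / 2) (y / 2) = quad_deriv k l m u v x y / 2"
    using quad_deriv_scale[of k l m u v "1 / 2" x y] by simp
  ultimately show ?thesis
    by (simp add: algebra_simps power2_eq_square)
qed

section \<open>The discrete momentum map\<close>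

text \<open>The interval is two-sided so that the box contains the slice at parameter 0, where the
  limits of the branches are read off.\<close>

lemma open_product_neighbourhood:
  fixes S :: "('a::real_normed_vector \<times> real) set"
  assumes "open S" "0 \<in> S"
  obtains N e where "open N" "0 \<in> N" "0 < e" "N \<times> {- e <..< e} \<subseteq> S"
proof -
  obtain N A where "open N" "open A" "0 \<in> N \<times> A" "N \<times> A \<subseteq> S"
    using open_prod_elim[OF assms] by blast
  then have NA: "open N" "open A" "0 \<in> N" "0 \<in> A" "N \<times> A \<subseteq> S"
    by (auto simp: zero_prod_def)
  obtain e where "e > 0" "ball 0 e \<subseteq> A"
    using NA openE by blast
  then have "N \<times> {- e <..< e} \<subseteq> S"
    using NA(5) by (force simp: dist_real_def)
  then show thesis
    using that NA \<open>e > 0\<close> by blast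
qed

lemma tendsto_at_right_0_of_continuous_on:
  fixes f :: "'a::real_normed_vector \<times> real \<Rightarrow> 'b::topological_space"
  assumes "open S" "continuous_on S f" "(x, 0) \<in> S"
  shows "((\<lambda>\<epsilon>. f (x, \<epsilon>)) \<longlongrightarrow> f (x, 0)) (at_right 0)"
proof (rule isCont_tendsto_compose)
  show "isCont f (x, 0)"
    using assms continuous_on_eq_continuous_at by blast
  show "((\<lambda>\<epsilon>. (x, \<epsilon>)) \<longlongrightarrow> (x, 0)) (at_right 0)"
    by (intro tendsto_intros)
qed

lemma Ck_on_plane_Legendre:
  assumes "open S" "Ck_on k e S"
  shows "Ck_on k (\<lambda>z. plane_Legendre I (e z) (fst z)) S"
proof -
  have "Ck_on k (\<lambda>z. plane_Legendre I (e z) (fst (fst z), snd (fst z))) S"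
    unfolding plane_Legendre_def prod.case by (intro Ck_on_intros assms) simp_all
  then show ?thesis by simp
qed

context
  fixes I :: "real^3^3"
  assumes I: "inertia_tensor I" "I $ 1 $ 2 = 0"
begin

section \<open>Smooth branches near the origin\<close>

text \<open>The time step is treated as a variable near 0, with 0 and negative values included. At
  the origin the planar Jacobian is the product of two positive diagonal entries of
  \<open>I\<close>.\<close>

lemma plane_Legendre_local_inverse:
  obtains U V g where "open U" "0 \<in> U" "open V" "0 \<in> V" "smooth_on V g"
    "\<forall>x \<epsilon>. (x, \<epsilon>) \<in> U \<longrightarrow> g (plane_Legendre I \<epsilon> x, \<epsilon>) = (x, \<epsilon>)"
    "\<forall>m \<epsilon>. (m, \<epsilon>) \<in> V \<longrightarrow> (plane_Legendre I (snd (g (m, \<epsilon>))) (fst (g (m, \<epsilon>))), snd (g (m, \<epsilon>))) = (m, \<epsilon>)"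
proof -
  define P where "P z = fst (plane_Legendre I (snd z) (fst z))" for z
  define Q where "Q z = snd (plane_Legendre I (snd z) (fst z))" for z
  have ck: "Ck_on k (\<lambda>z. plane_Legendre I (snd z) (fst z)) UNIV" for k
    by (intro Ck_on_plane_Legendre Ck_on_intros open_UNIV)
  have sm: "smooth_on UNIV P" "smooth_on UNIV Q"
    unfolding smooth_on_def P_def[abs_def] Q_def[abs_def]
    using Ck_on_fst[OF open_UNIV ck] Ck_on_snd[OF open_UNIV ck] by blast+
  \<comment> \<open>All other terms have degree at least two in (u, v, \<epsilon>).\<close>
  have "(P has_derivative (\<lambda>w. I $ 1 $ 1 * fst (fst w))) (at 0)"
    "(Q has_derivative (\<lambda>w. I $ 2 $ 2 * snd (fst w))) (at 0)"
    unfolding P_def[abs_def] Q_def[abs_def] plane_Legendre_def split_def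
    by (auto intro!: derivative_eq_intros simp: power2_eq_square)
  then have "frechet_derivative P (at 0) = (\<lambda>w. I $ 1 $ 1 * fst (fst w))"
    "frechet_derivative Q (at 0) = (\<lambda>w. I $ 2 $ 2 * snd (fst w))"
    by (simp_all only: frechet_derivative_at[symmetric])
  then have J: "planar_jacobian P Q 0 \<noteq> 0"
    using inertia_entries(5,6)[OF I] by (simp add: planar_jacobian_def partial_def)
  define F where "F z = (plane_Legendre I (snd z) (fst z), snd z)" for z
  have F: "F = (\<lambda>z. ((P z, Q z), snd z))"
    by (simp add: fun_eq_iff F_def P_def Q_def)
  obtain U V g where UV: "open U" "0 \<in> U" "open V" "F 0 \<in> V" "homeomorphism U V F g" "smooth_on V g"
    using planar_smooth_inverse[OF F sm J] by metis
  show thesis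
  proof (rule that[of U V g])
    show "0 \<in> V"
      using UV(4) by (simp add: F_def plane_Legendre_def zero_prod_def)
    show "\<forall>x \<epsilon>. (x, \<epsilon>) \<in> U \<longrightarrow> g (plane_Legendre I \<epsilon> x, \<epsilon>) = (x, \<epsilon>)"
      using UV(5) unfolding homeomorphism_def by (metis F_def fst_conv snd_conv)
    show "\<forall>m \<epsilon>. (m, \<epsilon>) \<in> V \<longrightarrow>
        (plane_Legendre I (snd (g (m, \<epsilon>))) (fst (g (m, \<epsilon>))), snd (g (m, \<epsilon>))) = (m, \<epsilon>)"
      using UV(5) unfolding homeomorphism_def F_def by blast
  qed (use UV in auto)
qed

text \<open>Both branches come from the local inverse \<open>g\<close>: its planar part is
  \<open>G\<close>, and composing this with the Legendre map for \<open>- \<epsilon>\<close> gives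
  \<open>B\<close>. Since \<open>g\<close> is smooth across step 0, the limits are the values
  there.\<close>

lemma EPS_branch_and_plane_momentum_inverse_exist:
  "\<exists>D \<epsilon>0 B. EPS_branch I D \<epsilon>0 B" "\<exists>N \<epsilon>0 G. plane_momentum_inverse I N \<epsilon>0 G"
proof -
  obtain U V g where UV: "open U" "0 \<in> U" "open V" "0 \<in> V" "smooth_on V g"
    and gf: "\<forall>x \<epsilon>. (x, \<epsilon>) \<in> U \<longrightarrow> g (plane_Legendre I \<epsilon> x, \<epsilon>) = (x, \<epsilon>)"
    and fg0: "\<forall>m \<epsilon>. (m, \<epsilon>) \<in> V \<longrightarrow> (plane_Legendre I (snd (g (m, \<epsilon>))) (fst (g (m, \<epsilon>))), snd (g (m, \<epsilon>))) = (m, \<epsilon>)"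
    using plane_Legendre_local_inverse by metis
  have fg: "plane_Legendre I \<epsilon> (fst (g (m, \<epsilon>))) = m" if "(m, \<epsilon>) \<in> V" for m \<epsilon>
    using fg0[rule_format, OF that] by auto
  have ck: "Ck_on k (\<lambda>z. fst (g z)) V" for k
    using UV(3,5) by (auto simp: smooth_on_def intro: Ck_on_fst)
  have cont: "continuous_on V (\<lambda>z. fst (g z))"
    by (rule Ck_on_continuous[OF ck[of 0]])
  show "\<exists>N \<epsilon>0 G. plane_momentum_inverse I N \<epsilon>0 G"
  proof -
    obtain N e where N: "open N" "0 \<in> N" "0 < e" "N \<times> {- e <..< e} \<subseteq> V"
      using open_product_neighbourhood[OF UV(3,4)] .
    have sub: "N \<times> {0<..<e} \<subseteq> N \<times> {- e <..< e}"
      using N(3) by auto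
    let ?G = "\<lambda>\<epsilon> m. fst (g (m, \<epsilon>))"
    have 1: "smooth_on (N \<times> {0<..<e}) (\<lambda>(m, \<epsilon>). ?G \<epsilon> m)"
      unfolding smooth_on_def split_def prod.collapse
      using Ck_on_subset[OF ck subset_trans[OF sub N(4)]] by blast
    have 2: "plane_momentum I \<epsilon> (?G \<epsilon> m) = m" if "m \<in> N" "\<epsilon> \<in> {0<..<e}" for m \<epsilon>
    proof -
      have "(m, \<epsilon>) \<in> V"
        using that N(3,4) by auto
      then show ?thesis
        using fg that(2) by (simp add: plane_momentum_eq[OF I])
    qed
    have 3: "((\<lambda>\<epsilon>. ?G \<epsilon> m) \<longlongrightarrow> (fst m / I $ 1 $ 1, snd m / I $ 2 $ 2)) (at_right 0)"
      if "m \<in> N" for m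
    proof -
      have m0: "(m, 0) \<in> V"
        using that N(3,4) by auto
      \<comment> \<open>At step 0 the Legendre map is diagonal, so its inverse is explicit.\<close>
      have "fst (g (m, 0)) = (fst m / I $ 1 $ 1, snd m / I $ 2 $ 2)"
        using inertia_entries(5,6)[OF I]
        fg[OF m0]
        by (cases "fst (g (m, 0))") (auto simp: plane_Legendre_def)
      then show ?thesis
        using tendsto_at_right_0_of_continuous_on[OF UV(3) cont m0] by simp
    qed
    show ?thesis
      unfolding plane_momentum_inverse_def
      by (intro exI[of _ N] exI[of _ e] exI[of _ ?G] conjI ballI 1 2 3 N(1-3))
  qed
  show "\<exists>D \<epsilon>0 B. EPS_branch I D \<epsilon>0 B"
  proof -
    let ?k = "\<lambda>z. (plane_Legendre I (- snd z) (fst z), snd z)"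
    have ck_k: "Ck_on k ?k S" if "open S" for k S
      by (intro Ck_on_Pair Ck_on_plane_Legendre Ck_on_minus Ck_on_snd Ck_on_ident that)
    have k0: "?k 0 = 0"
      by (simp add: plane_Legendre_def zero_prod_def)
    \<comment> \<open>The condition on \<open>?k z\<close> places it in the domain of
      \<open>g\<close>. The condition that \<open>z\<close> lies in \<open>U\<close> makes
      \<open>g\<close> undo the map at step 0, which singles out the branch tending to the
      identity.\<close>
    define S where "S = U \<inter> ?k -` V"
    have S: "open S" "0 \<in> S"
      unfolding S_def using UV k0 Ck_on_continuous[OF ck_k[OF open_UNIV]]
      by (auto intro!: open_Int open_vimage)
    have ckS: "Ck_on j (\<lambda>z. fst (g (?k z))) S" for j
      by (rule Ck_on_compose[OF S(1) UV(3) ck ck_k[OF S(1)]]) (auto simp: S_def)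
    obtain N e where N: "open N" "0 \<in> N" "0 < e" "N \<times> {- e <..< e} \<subseteq> S"
      using open_product_neighbourhood[OF S] .
    have sub: "N \<times> {0<..<e} \<subseteq> N \<times> {- e <..< e}"
      using N(3) by auto
    let ?B = "\<lambda>\<epsilon> x. fst (g (plane_Legendre I (- \<epsilon>) x, \<epsilon>))"
    have 1: "smooth_on (N \<times> {0<..<e}) (\<lambda>(x, \<epsilon>). ?B \<epsilon> x)"
      unfolding smooth_on_def split_def
      using Ck_on_subset[OF ckS subset_trans[OF sub N(4)]] by blast
    have 2: "discrete_EPS I \<epsilon> (Cay_chart \<epsilon> x) (Cay_chart \<epsilon> (?B \<epsilon> x))"
      if "x \<in> N" "\<epsilon> \<in> {0<..<e}" for x \<epsilon>
    proof -
      have "(x, \<epsilon>) \<in> S"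
        using that N(3,4) by auto
      then have "(plane_Legendre I (- \<epsilon>) x, \<epsilon>) \<in> V"
        by (simp add: S_def)
      then show ?thesis
        using fg that(2) by (simp add: discrete_EPS_iff[OF I])
    qed
    have 3: "((\<lambda>\<epsilon>. ?B \<epsilon> x) \<longlongrightarrow> x) (at_right 0)" if "x \<in> N" for x
    proof -
      have x0: "(x, 0) \<in> S"
        using that N(3,4) by auto
      then have "g (plane_Legendre I 0 x, 0) = (x, 0)"
        using gf[rule_format] unfolding S_def by blast
      then show ?thesis
        using tendsto_at_right_0_of_continuous_on[OF S(1) Ck_on_continuous[OF ckS[of 0]] x0] by simp
    qed
    show ?thesis
      unfolding EPS_branch_def
      by (intro exI[of _ N] exI[of _ e] exI[of _ ?B] conjI ballI 1 2 3 N(1-3))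
  qed
qed

section \<open>Comparison of the scheme with the flow\<close>

text \<open>In u = M1 / \<alpha>, v = M2 / \<beta> the field is (- v (p u + q v), u (p u + q v)),
  the pair of forms with factor \<open>- \<epsilon> / 2\<close> in
  \<open>plane_Legendre\<close>.\<close>

lemma EPS_field_eq:
  defines "\<alpha> \<equiv> I $ 1 $ 1" and "\<beta> \<equiv> I $ 2 $ 2" and "p \<equiv> I $ 1 $ 3" and "q \<equiv> I $ 2 $ 3"
  shows "EPS_field I m = (quad 0 (- p) (- q) (fst m / \<alpha>) (snd m / \<beta>), quad p q 0 (fst m / \<alpha>) (snd m / \<beta>))"
  using inertia_entries(5,6)[OF I] unfolding \<alpha>_def \<beta>_def p_def q_def
  by (cases m) (simp add: EPS_field_def quad_def field_simps power2_eq_square)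

lemma local_truncation_error:
  assumes x: "(x \<longlongrightarrow> (fst m / I $ 1 $ 1, snd m / I $ 2 $ 2)) (at_right 0)"
    and mom: "\<forall>\<^sub>F \<epsilon> in at_right 0. plane_Legendre I \<epsilon> (x \<epsilon>) = m"
    and sol: "EPS_solution I m T M"
  shows "(\<lambda>\<epsilon>. fst (plane_Legendre I (- \<epsilon>) (x \<epsilon>)) - fst (M \<epsilon>)) \<in> O[at_right 0](\<lambda>\<epsilon>. \<epsilon> ^ 3)"
    and "(\<lambda>\<epsilon>. snd (plane_Legendre I (- \<epsilon>) (x \<epsilon>)) - snd (M \<epsilon>)) \<in> O[at_right 0](\<lambda>\<epsilon>. \<epsilon> ^ 3)"
proof -
  define \<alpha> \<beta> p q where defs: "\<alpha> = I $ 1 $ 1" "\<beta> = I $ 2 $ 2" "p = I $ 1 $ 3" "q = I $ 2 $ 3"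
  let ?k = "quad 0 (- p) (- q)" and ?l = "quad p q 0"
  define u v where uv: "u = fst m / \<alpha>" "v = snd m / \<beta>"
  define f g where fg: "f = (\<lambda>t. fst (x t))" "g = (\<lambda>t. snd (x t))"
  have pos: "\<alpha> \<noteq> 0" "\<beta> \<noteq> 0"
    using inertia_entries(5,6)[OF I] by (auto simp: defs)
  have lim: "(f \<longlongrightarrow> u) (at_right 0)" "(g \<longlongrightarrow> v) (at_right 0)"
    using tendsto_fst[OF x] tendsto_snd[OF x] by (simp_all add: fg uv defs)
  \<comment> \<open>Up to sign, the cubic terms of \<open>plane_Legendre\<close> without
    \<open>\<epsilon>\<^sup>2\<close>. Being even in \<open>\<epsilon>\<close>, they cancel between
    the steps \<open>\<epsilon>\<close> and \<open>- \<epsilon>\<close>.\<close>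
  define r where "r = (\<lambda>h t. - (h t * (\<alpha> * (f t)\<^sup>2 + \<beta> * (g t)\<^sup>2)) / 4 :: real)"
  have rO: "r h \<in> O[at_right 0](\<lambda>_. 1)" if "(h \<longlongrightarrow> w) (at_right 0)" for h w
    unfolding r_def
    by (rule at_right_0_bigo_1[where c = "- (w * (\<alpha> * u\<^sup>2 + \<beta> * v\<^sup>2)) / 4"])
      (auto intro!: tendsto_intros lim that)
  have L: "plane_Legendre I \<epsilon> (x \<epsilon>) =
      (\<alpha> * f \<epsilon> - \<epsilon> / 2 * ?k (f \<epsilon>) (g \<epsilon>) - \<epsilon>\<^sup>2 * r f \<epsilon>, \<beta> * g \<epsilon> - \<epsilon> / 2 * ?l (f \<epsilon>) (g \<epsilon>) - \<epsilon>\<^sup>2 * r g \<epsilon>)"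
    "plane_Legendre I (- \<epsilon>) (x \<epsilon>) =
      (\<alpha> * f \<epsilon> + \<epsilon> / 2 * ?k (f \<epsilon>) (g \<epsilon>) - \<epsilon>\<^sup>2 * r f \<epsilon>, \<beta> * g \<epsilon> + \<epsilon> / 2 * ?l (f \<epsilon>) (g \<epsilon>) - \<epsilon>\<^sup>2 * r g \<epsilon>)" for \<epsilon>
    by (simp_all add: plane_Legendre_def split_def quad_def r_def fg defs power2_eq_square algebra_simps
        add_divide_distrib diff_divide_distrib)
  have m: "m = (\<alpha> * u, \<beta> * v)"
    using pos by (simp add: uv)
  have ev: "\<forall>\<^sub>F t in at_right 0. \<alpha> * (f t - u) = t / 2 * ?k (f t) (g t) + t ^ 2 * r f t"
    "\<forall>\<^sub>F t in at_right 0. \<beta> * (g t - v) = t / 2 * ?l (f t) (g t) + t ^ 2 * r g t"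
    using mom unfolding L m by (auto elim!: eventually_mono simp: algebra_simps)
  note scheme = quad_scheme_expansion[OF pos lim rO[OF lim(1)] rO[OF lim(2)] ev]
  have M: "0 < T" "M 0 = m"
    and dM: "\<And>t. t \<in> {0..<T} \<Longrightarrow> (M has_vector_derivative EPS_field I (M t)) (at t within {0..<T})"
    using sol by (auto simp: EPS_solution_def)
  have d: "((\<lambda>t. fst (M t)) has_real_derivative ?k (fst (M t) / \<alpha>) (snd (M t) / \<beta>)) (at t within {0..<T})"
    "((\<lambda>t. snd (M t)) has_real_derivative ?l (fst (M t) / \<alpha>) (snd (M t) / \<beta>)) (at t within {0..<T})"
    if "t \<in> {0..<T}" for t
    using bounded_linear.has_vector_derivative[OF bounded_linear_fst dM[OF that]]
      bounded_linear.has_vector_derivative[OF bounded_linear_snd dM[OF that]]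
    by (simp_all add: EPS_field_eq defs has_real_derivative_iff_has_vector_derivative)
  note flow = quad_flow_expansion[OF M(1) pos d, unfolded M(2), folded uv]
  \<comment> \<open>The difference of the two formulas in \<open>L\<close> is \<open>t\<close> times
    the pair of forms, while the first formula equals \<open>m\<close>.\<close>
  have step: "\<forall>\<^sub>F t in at_right 0. plane_Legendre I (- t) (x t)
      = (fst m + t * ?k (f t) (g t), snd m + t * ?l (f t) (g t))"
    using mom by (rule eventually_mono) (unfold L, auto)
  have "(\<lambda>t. fst m + t * ?k (f t) (g t) - fst (M t)) \<in> O[at_right 0](\<lambda>t. t ^ 3)"
    using sum_in_bigo(2)[OF scheme[where k = 0 and l = "- p" and m = "- q"] flow(1)] by (simp add: algebra_simps)
  then show "(\<lambda>\<epsilon>. fst (plane_Legendre I (- \<epsilon>) (x \<epsilon>)) - fst (M \<epsilon>)) \<in> O[at_right 0](\<lambda>\<epsilon>. \<epsilon> ^ 3)"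
    by (rule landau_o.big.in_cong[THEN iffD2, rotated]) (use step in \<open>auto elim: eventually_mono\<close>)
  have "(\<lambda>t. snd m + t * ?l (f t) (g t) - snd (M t)) \<in> O[at_right 0](\<lambda>t. t ^ 3)"
    using sum_in_bigo(2)[OF scheme[where k = p and l = q and m = 0] flow(2)] by (simp add: algebra_simps)
  then show "(\<lambda>\<epsilon>. snd (plane_Legendre I (- \<epsilon>) (x \<epsilon>)) - snd (M \<epsilon>)) \<in> O[at_right 0](\<lambda>\<epsilon>. \<epsilon> ^ 3)"
    by (rule landau_o.big.in_cong[THEN iffD2, rotated]) (use step in \<open>auto elim: eventually_mono\<close>)
qed

text \<open>The discrete equations say that the momentum of \<open>B \<epsilon> x\<close> for the step \<open>\<epsilon>\<close> is the momentum of
  \<open>x\<close> for the step \<open>- \<epsilon>\<close>, so no control on \<open>B\<close> beyond its domain is needed.\<close>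

lemma projected_momentum_map_error:
  assumes B: "EPS_branch I D \<epsilon>1 B" and G: "plane_momentum_inverse I N \<epsilon>2 G"
  shows "\<exists>U. open U \<and> 0 \<in> U \<and> U \<subseteq> N \<and>
    (\<forall>m\<in>U. (\<forall>\<^sub>F \<epsilon> in at_right 0. G \<epsilon> m \<in> D) \<and>
      (\<forall>T M. EPS_solution I m T M \<longrightarrow>
        (\<lambda>\<epsilon>. fst (projected_momentum_map I B G \<epsilon> m) - fst (M \<epsilon>)) \<in> O[at_right 0](\<lambda>\<epsilon>. \<epsilon> ^ 3) \<and>
        (\<lambda>\<epsilon>. snd (projected_momentum_map I B G \<epsilon> m) - snd (M \<epsilon>)) \<in> O[at_right 0](\<lambda>\<epsilon>. \<epsilon> ^ 3)))"
proof -
  have D: "open D" "0 \<in> D" "0 < \<epsilon>1"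
    and EPS: "\<And>x \<epsilon>. x \<in> D \<Longrightarrow> \<epsilon> \<in> {0<..<\<epsilon>1} \<Longrightarrow> discrete_EPS I \<epsilon> (Cay_chart \<epsilon> x) (Cay_chart \<epsilon> (B \<epsilon> x))"
    using B by (auto simp: EPS_branch_def)
  have N: "open N" "0 \<in> N" "0 < \<epsilon>2"
    and inv: "\<And>m \<epsilon>. m \<in> N \<Longrightarrow> \<epsilon> \<in> {0<..<\<epsilon>2} \<Longrightarrow> plane_momentum I \<epsilon> (G \<epsilon> m) = m"
    and lim: "\<And>m. m \<in> N \<Longrightarrow>
      ((\<lambda>\<epsilon>. G \<epsilon> m) \<longlongrightarrow> (fst m / I $ 1 $ 1, snd m / I $ 2 $ 2)) (at_right 0)"
    using G unfolding plane_momentum_inverse_def by blast+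
  \<comment> \<open>\<open>L m\<close> is the limit of \<open>G \<epsilon> m\<close>; if it lies in
    the open set \<open>D\<close>, then so does \<open>G \<epsilon> m\<close> for small steps. This
    dictates the neighbourhood chosen below.\<close>
  define L where "L m = (fst m / I $ 1 $ 1, snd m / I $ 2 $ 2)" for m :: "real \<times> real"
  have cont_L: "continuous_on UNIV L"
    unfolding L_def using inertia_entries(5,6)[OF I] by (intro continuous_intros) auto
  show ?thesis
  proof (intro exI[of _ "N \<inter> L -` D"] conjI ballI allI impI)
    show "open (N \<inter> L -` D)"
      by (intro open_Int N open_vimage D cont_L)
    show "0 \<in> N \<inter> L -` D"
      using N D by (simp add: L_def zero_prod_def)
    fix m assume m: "m \<in> N \<inter> L -` D"
    have small: "\<forall>\<^sub>F \<epsilon> in at_right 0. \<epsilon> \<in> {0<..<min \<epsilon>1 \<epsilon>2}"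
      using D(3) N(3) by (intro eventually_at_right_real) simp
    show inD: "\<forall>\<^sub>F \<epsilon> in at_right 0. G \<epsilon> m \<in> D"
      using topological_tendstoD[OF lim D(1)] m by (simp add: L_def)
    have mom: "\<forall>\<^sub>F \<epsilon> in at_right 0. plane_Legendre I \<epsilon> (G \<epsilon> m) = m"
      using small by (rule eventually_mono) (use inv m plane_momentum_eq[OF I] in auto)
    have "projected_momentum_map I B G \<epsilon> m = plane_Legendre I (- \<epsilon>) (G \<epsilon> m)"
      if "\<epsilon> \<in> {0<..<min \<epsilon>1 \<epsilon>2}" "G \<epsilon> m \<in> D" for \<epsilon>
      using EPS[of "G \<epsilon> m" \<epsilon>] inv[of m \<epsilon>] that m
      by (simp add: projected_momentum_map_eq plane_momentum_eq[OF I] discrete_EPS_iff[OF I])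
    then have step: "\<forall>\<^sub>F \<epsilon> in at_right 0.
        projected_momentum_map I B G \<epsilon> m = plane_Legendre I (- \<epsilon>) (G \<epsilon> m)"
      using eventually_conj[OF small inD] by (auto elim: eventually_mono)
    fix T M assume sol: "EPS_solution I m T M"
    have "m \<in> N" using m by simp
    note err = local_truncation_error[OF lim[OF this] mom sol]
    show "(\<lambda>\<epsilon>. fst (projected_momentum_map I B G \<epsilon> m) - fst (M \<epsilon>)) \<in> O[at_right 0](\<lambda>\<epsilon>. \<epsilon> ^ 3)"
      by (rule landau_o.big.in_cong[THEN iffD2, OF _ err(1)]) (use step in \<open>auto elim: eventually_mono\<close>)
    show "(\<lambda>\<epsilon>. snd (projected_momentum_map I B G \<epsilon> m) - snd (M \<epsilon>)) \<in> O[at_right 0](\<lambda>\<epsilon>. \<epsilon> ^ 3)"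
      by (rule landau_o.big.in_cong[THEN iffD2, OF _ err(2)]) (use step in \<open>auto elim: eventually_mono\<close>)
  qed blast
qed

end

theorem theorem6p1:
  fixes I :: "real^3^3"
  assumes "inertia_tensor I" and "I $ 1 $ 2 = 0"
  shows "(\<exists>D \<epsilon>0 B. EPS_branch I D \<epsilon>0 B) \<and>
         (\<exists>N \<epsilon>0 G. plane_momentum_inverse I N \<epsilon>0 G) \<and>
         (\<forall>D \<epsilon>1 B N \<epsilon>2 G.
            EPS_branch I D \<epsilon>1 B \<longrightarrow> plane_momentum_inverse I N \<epsilon>2 G \<longrightarrow>
            (\<exists>U. open U \<and> 0 \<in> U \<and> U \<subseteq> N \<and>
               (\<forall>m\<in>U. (\<forall>\<^sub>F \<epsilon> in at_right 0. G \<epsilon> m \<in> D) \<and>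
                 (\<forall>T M. EPS_solution I m T M \<longrightarrow>
                    (\<lambda>\<epsilon>. fst (projected_momentum_map I B G \<epsilon> m) - fst (M \<epsilon>))
                       \<in> O[at_right 0](\<lambda>\<epsilon>. \<epsilon> ^ 3) \<and>
                    (\<lambda>\<epsilon>. snd (projected_momentum_map I B G \<epsilon> m) - snd (M \<epsilon>))
                       \<in> O[at_right 0](\<lambda>\<epsilon>. \<epsilon> ^ 3)))))"
  using EPS_branch_and_plane_momentum_inverse_exist[OF assms]
  by (intro conjI allI impI projected_momentum_map_error[OF assms])

end
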